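(* Let $\kappa$ be an inaccessible cardinal such that the sententially categorical cardinals are unbounded in the inaccessible cardinals below $\kappa$ (i.e. for every inaccessible $\delta<\kappa$ there is a sententially categorical cardinal $\gamma$ with $\delta\le\gamma<\kappa$). Then $\kappa$ is first-order theory categorical.
   Context: $V_\kappa$ denotes the rank-initial segment of the cumulative hierarchy. A cardinal is sententially categorical if it is first-order or second-order sententially categorical, where $\gamma$ is first-order (resp. second-order) sententially categorical if there is a first-order (resp. second-order, with second-order quantifiers over all subsets of $V_\gamma$) sentence $\sigma$ such that $\gamma$ is inaccessible, $V_\gamma\models\sigma$, and $V_\lambda\not\models\sigma$ for all inaccessible $\lambda\neq\gamma$. A cardinal $\kappa$ is first-order theory categorical if $\kappa$ is inaccessible and there is a first-order theory $T$ with $V_\kappa\models T$ and $V_\lambda\not\models T$ for every inaccessible $\lambda\neq\kappa$. *)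

theory Defs
  imports "HOL-Library.Equipollence" "HOL-Library.Countable_Set"
begin

text \<open>
  The ambient universe of sets is an arbitrary type satisfying the axioms of ZFC. As usual for
  set theory over HOL, the two schemas range over arbitrary HOL predicates and functions.
  Consequently every subcollection of a set is a set, every map between sets is a set, and the
  universe's natural numbers are the HOL ones, so that formulas can be taken to be the elements
  of a HOL datatype.
\<close>

class zfc =
  fixes mem :: "'a \<Rightarrow> 'a \<Rightarrow> bool" (infix "\<in>\<^sub>V" 50)
  assumes extensionality: "(\<And>z. z \<in>\<^sub>V x \<longleftrightarrow> z \<in>\<^sub>V y) \<Longrightarrow> x = y"
    and foundation: "\<exists>y. y \<in>\<^sub>V x \<Longrightarrow> \<exists>y. y \<in>\<^sub>V x \<and> (\<forall>z. z \<in>\<^sub>V y \<longrightarrow> \<not> z \<in>\<^sub>V x)"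
    and pairing: "\<exists>p. \<forall>z. z \<in>\<^sub>V p \<longleftrightarrow> z = x \<or> z = y"
    and union: "\<exists>u. \<forall>z. z \<in>\<^sub>V u \<longleftrightarrow> (\<exists>y. y \<in>\<^sub>V x \<and> z \<in>\<^sub>V y)"
    and powerset: "\<exists>p. \<forall>y. y \<in>\<^sub>V p \<longleftrightarrow> (\<forall>z. z \<in>\<^sub>V y \<longrightarrow> z \<in>\<^sub>V x)"
    and infinity: "\<exists>w. (\<exists>e. e \<in>\<^sub>V w \<and> (\<forall>z. \<not> z \<in>\<^sub>V e)) \<and>
      (\<forall>x. x \<in>\<^sub>V w \<longrightarrow> (\<exists>s. s \<in>\<^sub>V w \<and> (\<forall>z. z \<in>\<^sub>V s \<longleftrightarrow> z \<in>\<^sub>V x \<or> z = x)))"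
    and separation: "\<exists>y. \<forall>z. z \<in>\<^sub>V y \<longleftrightarrow> z \<in>\<^sub>V x \<and> P z"
    and replacement: "\<exists>y. \<forall>z. z \<in>\<^sub>V y \<longleftrightarrow> (\<exists>w. w \<in>\<^sub>V x \<and> z = F w)"
    and choice: "\<lbrakk>\<And>y. y \<in>\<^sub>V x \<Longrightarrow> \<exists>z. z \<in>\<^sub>V y;
        \<And>y y' z. \<lbrakk>y \<in>\<^sub>V x; y' \<in>\<^sub>V x; z \<in>\<^sub>V y; z \<in>\<^sub>V y'\<rbrakk> \<Longrightarrow> y = y'\<rbrakk>
      \<Longrightarrow> \<exists>c. \<forall>y. y \<in>\<^sub>V x \<longrightarrow> (\<exists>!z. z \<in>\<^sub>V y \<and> z \<in>\<^sub>V c)"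

definition elts :: "'v::zfc \<Rightarrow> 'v set"
  where "elts x = {y. y \<in>\<^sub>V x}"

lemma mem_irrefl: "\<not> (x::'v::zfc) \<in>\<^sub>V x"
proof
  assume "x \<in>\<^sub>V x"
  obtain p where p: "\<And>z. z \<in>\<^sub>V p \<longleftrightarrow> z = x" using pairing[of x x] by auto
  then show False using foundation[of p] \<open>x \<in>\<^sub>V x\<close> by auto
qed

lemma wf_mem: "wf {(x, y::'v::zfc). x \<in>\<^sub>V y}"
proof (rule wfI_min)
  fix a :: 'v and Q assume "a \<in> Q"
  obtain w :: 'v where w0: "\<exists>e. e \<in>\<^sub>V w \<and> (\<forall>z. \<not> z \<in>\<^sub>V e)"
    and wS: "\<And>x. x \<in>\<^sub>V w \<Longrightarrow> \<exists>s. s \<in>\<^sub>V w \<and> (\<forall>z. z \<in>\<^sub>V s \<longleftrightarrow> z \<in>\<^sub>V x \<or> z = x)"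
    using infinity by blast
  obtain S where S: "\<And>x. x \<in>\<^sub>V w \<Longrightarrow> S x \<in>\<^sub>V w \<and> (\<forall>z. z \<in>\<^sub>V S x \<longleftrightarrow> z \<in>\<^sub>V x \<or> z = x)"
    using wS by metis
  obtain e where e: "e \<in>\<^sub>V w" using w0 by blast
  define N where "N n = (S ^^ n) e" for n
  have Nw: "N n \<in>\<^sub>V w" for n by (induction n) (auto simp: N_def e S)
  have Nlt: "m < n \<Longrightarrow> N m \<in>\<^sub>V N n" for m n
  proof (induction n)
    case (Suc n)
    have "z \<in>\<^sub>V N (Suc n) \<longleftrightarrow> z \<in>\<^sub>V N n \<or> z = N n" for z
      using S[OF Nw[of n]] by (simp add: N_def)
    then show ?case using Suc by (metis less_Suc_eq)
  qed simp
  have "inj N"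
    by (rule injI) (metis Nlt linorder_neqE_nat mem_irrefl)
  obtain U where U: "\<And>x z::'v. z \<in>\<^sub>V U x \<longleftrightarrow> (\<exists>y. y \<in>\<^sub>V x \<and> z \<in>\<^sub>V y)"
    using union by metis
  define f where "f n = (U ^^ n) a" for n
  obtain r where r: "\<And>z. z \<in>\<^sub>V r \<longleftrightarrow> (\<exists>v. v \<in>\<^sub>V w \<and> z = f (inv N v))"
    using replacement[of w "\<lambda>v. f (inv N v)"] by blast
  have fr: "f n \<in>\<^sub>V r" for n
    using r Nw[of n] inv_f_f[OF \<open>inj N\<close>, of n] by metis
  have trans: "\<exists>m. z \<in>\<^sub>V f m" if "y \<in>\<^sub>V f n" "z \<in>\<^sub>V y" for y z n
    using that U[of z "f n"] by (intro exI[of _ "Suc n"]) (auto simp: f_def)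
  obtain q where q: "\<And>z. z \<in>\<^sub>V q \<longleftrightarrow> z \<in>\<^sub>V U r \<and> ((\<exists>n. z \<in>\<^sub>V f n) \<and> z \<in> Q)"
    using separation[of "U r" "\<lambda>z. (\<exists>n. z \<in>\<^sub>V f n) \<and> z \<in> Q"] by blast
  have q': "z \<in>\<^sub>V q \<longleftrightarrow> (\<exists>n. z \<in>\<^sub>V f n) \<and> z \<in> Q" for z
    using q U fr by blast
  show "\<exists>z\<in>Q. \<forall>y. (y, z) \<in> {(x, y). x \<in>\<^sub>V y} \<longrightarrow> y \<notin> Q"
  proof (cases "\<exists>z. z \<in>\<^sub>V q")
    case True
    then show ?thesis using foundation[of q] q' trans by fastforce
  next
    case False
    have "f 0 = a" by (simp add: f_def)
    then show ?thesis using False q' \<open>a \<in> Q\<close> by (metis case_prodD mem_Collect_eq)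
  qed
qed

text \<open>
  The cumulative hierarchy, \<open>V\<^sub>\<alpha> = (\<Union>\<beta><\<alpha>. \<P>(V\<^sub>\<beta>))\<close>. Each stage is represented by
  the HOL set of its elements.
\<close>

function Vset :: "'v::zfc \<Rightarrow> 'v set"
  where "Vset \<alpha> = (\<Union>\<beta>\<in>elts \<alpha>. {x. elts x \<subseteq> Vset \<beta>})"
  by auto
termination
  by (relation "{(x, y). x \<in>\<^sub>V y}") (auto simp: wf_mem elts_def)

declare Vset.simps [simp del]

definition transitive :: "'v::zfc \<Rightarrow> bool"
  where "transitive x \<longleftrightarrow> (\<forall>y\<in>elts x. elts y \<subseteq> elts x)"

definition ordinal :: "'v::zfc \<Rightarrow> bool"
  where "ordinal \<alpha> \<longleftrightarrow> transitive \<alpha> \<and> (\<forall>\<beta>\<in>elts \<alpha>. transitive \<beta>)"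

definition cardinal :: "'v::zfc \<Rightarrow> bool"
  where "cardinal \<kappa> \<longleftrightarrow> ordinal \<kappa> \<and> (\<forall>\<alpha>\<in>elts \<kappa>. \<not> elts \<alpha> \<approx> elts \<kappa>)"

definition regular :: "'v::zfc \<Rightarrow> bool"
  where "regular \<kappa> \<longleftrightarrow>
    (\<forall>A \<subseteq> elts \<kappa>. (\<forall>\<alpha>\<in>elts \<kappa>. \<exists>\<beta>\<in>A. \<alpha> = \<beta> \<or> \<alpha> \<in>\<^sub>V \<beta>) \<longrightarrow> A \<approx> elts \<kappa>)"

definition strong_limit :: "'v::zfc \<Rightarrow> bool"
  where "strong_limit \<kappa> \<longleftrightarrow> (\<forall>\<alpha>\<in>elts \<kappa>. Pow (elts \<alpha>) \<prec> elts \<kappa>)"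

definition inaccessible :: "'v::zfc \<Rightarrow> bool"
  where "inaccessible \<kappa> \<longleftrightarrow>
    cardinal \<kappa> \<and> uncountable (elts \<kappa>) \<and> regular \<kappa> \<and> strong_limit \<kappa>"

text \<open>
  Second-order formulas in the language of set theory. Individual variables and set variables
  are separate sorts, each named by natural numbers; \<open>In i j\<close> says that the value of the
  individual variable \<open>i\<close> belongs to the value of the set variable \<open>j\<close>.
\<close>

datatype fm =
    Eq nat nat
  | Mem nat nat
  | In nat nat
  | Neg fm
  | Conj fm fm
  | Forall nat fm
  | Forall2 nat fm

primrec first_order :: "fm \<Rightarrow> bool" where
  "first_order (Eq i j) \<longleftrightarrow> True"
| "first_order (Mem i j) \<longleftrightarrow> True"
| "first_order (In i j) \<longleftrightarrow> False"
| "first_order (Neg \<phi>) \<longleftrightarrow> first_order \<phi>"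
| "first_order (Conj \<phi> \<psi>) \<longleftrightarrow> first_order \<phi> \<and> first_order \<psi>"
| "first_order (Forall i \<phi>) \<longleftrightarrow> first_order \<phi>"
| "first_order (Forall2 i \<phi>) \<longleftrightarrow> False"

primrec free_vars :: "fm \<Rightarrow> nat set" where
  "free_vars (Eq i j) = {i, j}"
| "free_vars (Mem i j) = {i, j}"
| "free_vars (In i j) = {i}"
| "free_vars (Neg \<phi>) = free_vars \<phi>"
| "free_vars (Conj \<phi> \<psi>) = free_vars \<phi> \<union> free_vars \<psi>"
| "free_vars (Forall i \<phi>) = free_vars \<phi> - {i}"
| "free_vars (Forall2 i \<phi>) = free_vars \<phi>"

primrec free_set_vars :: "fm \<Rightarrow> nat set" where
  "free_set_vars (Eq i j) = {}"
| "free_set_vars (Mem i j) = {}"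
| "free_set_vars (In i j) = {j}"
| "free_set_vars (Neg \<phi>) = free_set_vars \<phi>"
| "free_set_vars (Conj \<phi> \<psi>) = free_set_vars \<phi> \<union> free_set_vars \<psi>"
| "free_set_vars (Forall i \<phi>) = free_set_vars \<phi>"
| "free_set_vars (Forall2 i \<phi>) = free_set_vars \<phi> - {i}"

definition sentence :: "fm \<Rightarrow> bool"
  where "sentence \<sigma> \<longleftrightarrow> free_vars \<sigma> = {} \<and> free_set_vars \<sigma> = {}"

primrec sat :: "'v::zfc set \<Rightarrow> (nat \<Rightarrow> 'v) \<Rightarrow> (nat \<Rightarrow> 'v set) \<Rightarrow> fm \<Rightarrow> bool" where
  "sat M s S (Eq i j) \<longleftrightarrow> s i = s j"
| "sat M s S (Mem i j) \<longleftrightarrow> s i \<in>\<^sub>V s j"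
| "sat M s S (In i j) \<longleftrightarrow> s i \<in> S j"
| "sat M s S (Neg \<phi>) \<longleftrightarrow> \<not> sat M s S \<phi>"
| "sat M s S (Conj \<phi> \<psi>) \<longleftrightarrow> sat M s S \<phi> \<and> sat M s S \<psi>"
| "sat M s S (Forall i \<phi>) \<longleftrightarrow> (\<forall>x\<in>M. sat M (s(i := x)) S \<phi>)"
| "sat M s S (Forall2 i \<phi>) \<longleftrightarrow> (\<forall>X\<subseteq>M. sat M s (S(i := X)) \<phi>)"

definition models :: "'v::zfc set \<Rightarrow> fm \<Rightarrow> bool" (infix "\<Turnstile>" 50)
  where "M \<Turnstile> \<sigma> \<longleftrightarrow> (\<forall>s S. range s \<subseteq> M \<and> (\<forall>i. S i \<subseteq> M) \<longrightarrow> sat M s S \<sigma>)"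

definition first_order_sententially_categorical :: "'v::zfc \<Rightarrow> bool"
  where "first_order_sententially_categorical \<gamma> \<longleftrightarrow>
    (\<exists>\<sigma>. sentence \<sigma> \<and> first_order \<sigma> \<and> inaccessible \<gamma> \<and> Vset \<gamma> \<Turnstile> \<sigma> \<and>
      (\<forall>\<mu>. inaccessible \<mu> \<and> \<mu> \<noteq> \<gamma> \<longrightarrow> \<not> Vset \<mu> \<Turnstile> \<sigma>))"

definition second_order_sententially_categorical :: "'v::zfc \<Rightarrow> bool"
  where "second_order_sententially_categorical \<gamma> \<longleftrightarrow>
    (\<exists>\<sigma>. sentence \<sigma> \<and> inaccessible \<gamma> \<and> Vset \<gamma> \<Turnstile> \<sigma> \<and>
      (\<forall>\<mu>. inaccessible \<mu> \<and> \<mu> \<noteq> \<gamma> \<longrightarrow> \<not> Vset \<mu> \<Turnstile> \<sigma>))"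

definition sententially_categorical :: "'v::zfc \<Rightarrow> bool"
  where "sententially_categorical \<gamma> \<longleftrightarrow>
    first_order_sententially_categorical \<gamma> \<or> second_order_sententially_categorical \<gamma>"

definition first_order_theory :: "fm set \<Rightarrow> bool"
  where "first_order_theory T \<longleftrightarrow> (\<forall>\<sigma>\<in>T. sentence \<sigma> \<and> first_order \<sigma>)"

definition models_theory :: "'v::zfc set \<Rightarrow> fm set \<Rightarrow> bool" (infix "\<Turnstile>\<^sub>T" 50)
  where "M \<Turnstile>\<^sub>T T \<longleftrightarrow> (\<forall>\<sigma>\<in>T. M \<Turnstile> \<sigma>)"

definition first_order_theory_categorical :: "'v::zfc \<Rightarrow> bool"
  where "first_order_theory_categorical \<kappa> \<longleftrightarrow>
    inaccessible \<kappa> \<and>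
    (\<exists>T. first_order_theory T \<and> Vset \<kappa> \<Turnstile>\<^sub>T T \<and>
      (\<forall>\<mu>. inaccessible \<mu> \<and> \<mu> \<noteq> \<kappa> \<longrightarrow> \<not> Vset \<mu> \<Turnstile>\<^sub>T T))"

end

theory Submission
  imports Defs
begin

text \<open>
  Let \<open>T\<close> be the first-order theory of \<open>V\<^sub>\<kappa>\<close> and suppose \<open>V\<^sub>\<mu>\<close> satisfies \<open>T\<close> for an
  inaccessible \<open>\<mu> \<noteq> \<kappa>\<close>. Second-order truth in \<open>V\<^sub>\<gamma>\<close> is first-order over every \<open>V\<^sub>\<lambda>\<close> with
  \<open>\<lambda>\<close> inaccessible above \<open>\<gamma>\<close>, so \<open>T\<close> decides for each \<open>\<sigma>\<close> whether an inaccessible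
  stage satisfies \<open>\<sigma>\<close>.

  If \<open>\<mu> < \<kappa>\<close>, take a categorical \<open>\<gamma>\<close> with \<open>\<mu> \<le> \<gamma> < \<kappa>\<close>: its sentence holds in some
  inaccessible stage below \<open>\<kappa>\<close>, but in none below \<open>\<mu>\<close>.

  If \<open>\<mu> > \<kappa>\<close>, use the single first-order sentence saying that above every inaccessible \<open>\<delta>\<close>
  there is an inaccessible \<open>\<gamma> \<ge> \<delta>\<close> and a second-order sentence whose first inaccessible model is
  \<open>V\<^sub>\<gamma>\<close>. It holds in \<open>V\<^sub>\<kappa>\<close>, hence in \<open>V\<^sub>\<mu>\<close>. With \<open>\<delta> = \<kappa>\<close> it gives a sentence that has an
  inaccessible model below \<open>\<mu>\<close> but none below \<open>\<kappa>\<close>, against the equivalence of the two stages.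
\<close>

section \<open>Sets\<close>

lemma elts_iff: "y \<in> elts x \<longleftrightarrow> y \<in>\<^sub>V x"
  by (simp add: elts_def)

lemma elts_inject [simp]: "elts x = elts y \<longleftrightarrow> x = y"
  using extensionality[of x y] by (auto simp: elts_def set_eq_iff)

lemma mem_induct [case_names mem]:
  fixes x :: "'v::zfc"
  assumes "\<And>x. (\<And>y. y \<in> elts x \<Longrightarrow> P y) \<Longrightarrow> P x"
  shows "P x"
  using wf_mem
proof (induction x rule: wf_induct_rule)
  case (less x)
  then show ?case using assms by (auto simp: elts_def)
qed

lemma notin_elts_self [simp]: "x \<notin> elts x"
  by (simp add: elts_iff mem_irrefl)

lemma elts_not_sym: "x \<in> elts y \<Longrightarrow> y \<notin> elts x"
  using wf_mem[THEN wf_not_sym, of x y] by (auto simp: elts_def)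

text \<open>HOL sets and elements of the universe are kept apart; small HOL sets are those that
  \<open>vset\<close> turns into elements. As separation and replacement range over arbitrary HOL
  predicates and functions, subsets and images of small sets are small.\<close>

definition small :: "'v::zfc set \<Rightarrow> bool"
  where "small X \<longleftrightarrow> (\<exists>z. elts z = X)"

definition vset :: "'v::zfc set \<Rightarrow> 'v"
  where "vset X = (THE z. elts z = X)"

lemma elts_vset [simp]: "small X \<Longrightarrow> elts (vset X) = X"
  unfolding small_def vset_def by auto

lemma small_elts [simp]: "small (elts x)"
  by (auto simp: small_def)

lemma small_subset: "small X \<Longrightarrow> Y \<subseteq> X \<Longrightarrow> small Y"
proof -
  assume "small X" "Y \<subseteq> X"
  then obtain x where x: "elts x = X" by (auto simp: small_def)
  obtain y where "\<And>z. z \<in>\<^sub>V y \<longleftrightarrow> z \<in>\<^sub>V x \<and> z \<in> Y"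
    using separation[of x "\<lambda>z. z \<in> Y"] by blast
  then have "elts y = Y" using x \<open>Y \<subseteq> X\<close> by (auto simp: elts_def)
  then show ?thesis by (auto simp: small_def)
qed

lemma small_image: "small X \<Longrightarrow> small ((F :: 'v \<Rightarrow> 'v::zfc) ` X)"
proof -
  assume "small X"
  then obtain x where x: "elts x = X" by (auto simp: small_def)
  obtain y where "\<And>z. z \<in>\<^sub>V y \<longleftrightarrow> (\<exists>w. w \<in>\<^sub>V x \<and> z = F w)"
    using replacement[of x F] by blast
  then have "elts y = F ` X" using x by (auto simp: elts_def)
  then show ?thesis by (auto simp: small_def)
qed

lemma small_UN:
  fixes F :: "'v::zfc \<Rightarrow> 'v set"
  assumes "small X" "\<And>x. x \<in> X \<Longrightarrow> small (F x)"
  shows "small (\<Union>x\<in>X. F x)"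
proof -
  obtain a where a: "elts a = (\<lambda>x. vset (F x)) ` X"
    using small_image[OF assms(1)] unfolding small_def by metis
  obtain u where "\<And>z. z \<in>\<^sub>V u \<longleftrightarrow> (\<exists>y. y \<in>\<^sub>V a \<and> z \<in>\<^sub>V y)"
    using union[of a] by blast
  then have "elts u = (\<Union>y\<in>elts a. elts y)" by (auto simp: elts_def)
  also have "\<dots> = (\<Union>x\<in>X. F x)" using assms(2) by (auto simp: a)
  finally show ?thesis by (auto simp: small_def)
qed

text \<open>By separation every HOL subset of \<open>elts x\<close> is represented here, so a
  quantifier over \<open>subsets x\<close> is a full second-order quantifier over
  \<open>x\<close>.\<close>

definition subsets :: "'v::zfc \<Rightarrow> 'v set"
  where "subsets x = {y. elts y \<subseteq> elts x}"

lemma in_subsets [simp]: "y \<in> subsets x \<longleftrightarrow> elts y \<subseteq> elts x"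
  by (simp add: subsets_def)

lemma small_subsets [simp]: "small (subsets x)"
proof -
  obtain p where "\<And>y. y \<in>\<^sub>V p \<longleftrightarrow> (\<forall>z. z \<in>\<^sub>V y \<longrightarrow> z \<in>\<^sub>V x)"
    using powerset[of x] by blast
  then have "elts p = subsets x" by (auto simp: elts_def subsets_def)
  then show ?thesis by (auto simp: small_def)
qed

lemma small_upair [simp]: "small {x, y}"
proof -
  obtain p where "\<And>z. z \<in>\<^sub>V p \<longleftrightarrow> z = x \<or> z = y" using pairing[of x y] by blast
  then have "elts p = {x, y}" by (auto simp: elts_def)
  then show ?thesis by (auto simp: small_def)
qed

lemma small_empty [simp]: "small {}"
  using small_subset[OF small_upair] by blast

lemma small_Un: "small X \<Longrightarrow> small Y \<Longrightarrow> small (X \<union> Y)"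
proof -
  assume "small X" "small Y"
  then have "small (\<Union>x\<in>{vset X, vset Y}. elts x)" by (intro small_UN) auto
  then show ?thesis using \<open>small X\<close> \<open>small Y\<close> by simp
qed

lemma small_insert: "small X \<Longrightarrow> small (insert x X)"
  using small_Un[OF small_upair[of x x], of X] by simp

section \<open>Kuratowski pairs, relations, successors and numerals\<close>

definition upair :: "'v::zfc \<Rightarrow> 'v \<Rightarrow> 'v"
  where "upair x y = vset {x, y}"

lemma elts_upair [simp]: "elts (upair x y) = {x, y}"
  by (simp add: upair_def)

definition pair :: "'v::zfc \<Rightarrow> 'v \<Rightarrow> 'v"
  where "pair x y = upair (upair x x) (upair x y)"

lemma upair_eq_iff: "z = upair x y \<longleftrightarrow> elts z = {x, y}"
  by (metis elts_inject elts_upair)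

lemma pair_inject [simp]: "pair x y = pair x' y' \<longleftrightarrow> x = x' \<and> y = y'"
  by (auto simp: pair_def upair_eq_iff doubleton_eq_iff)

definition rel :: "'v::zfc \<Rightarrow> 'v \<Rightarrow> 'v \<Rightarrow> bool"
  where "rel r x y \<longleftrightarrow> pair x y \<in> elts r"

definition vsucc :: "'v::zfc \<Rightarrow> 'v"
  where "vsucc x = vset (insert x (elts x))"

lemma elts_vsucc [simp]: "elts (vsucc x) = insert x (elts x)"
  by (simp add: vsucc_def small_insert)

primrec num :: "nat \<Rightarrow> 'v::zfc" where
  "num 0 = vset {}"
| "num (Suc n) = vsucc (num n)"

lemma elts_num: "elts (num n) = num ` {..<n}"
  by (induction n) (auto simp: lessThan_Suc)

lemma num_inject [simp]: "num m = (num n :: 'v::zfc) \<longleftrightarrow> m = n"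
proof
  assume eq: "num m = (num n :: 'v)"
  have "num k \<in> elts (num l :: 'v)" if "k < l" for k l
    using that by (auto simp: elts_num)
  then show "m = n" using eq by (metis linorder_neqE_nat notin_elts_self)
qed simp

section \<open>Ordinals and the cumulative hierarchy\<close>

lemma transitive_num: "transitive (num n)"
  unfolding transitive_def by (fastforce simp: elts_num)

lemma ordinal_num: "ordinal (num n)"
  unfolding ordinal_def using transitive_num by (auto simp: elts_num)

lemma ordinal_mem: "ordinal \<alpha> \<Longrightarrow> \<beta> \<in> elts \<alpha> \<Longrightarrow> ordinal \<beta>"
  unfolding ordinal_def transitive_def by blast

lemma ordinal_trans: "ordinal \<alpha> \<Longrightarrow> \<beta> \<in> elts \<alpha> \<Longrightarrow> \<gamma> \<in> elts \<beta> \<Longrightarrow> \<gamma> \<in> elts \<alpha>"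
  unfolding ordinal_def transitive_def by blast

lemma ordinal_vsucc: "ordinal \<alpha> \<Longrightarrow> ordinal (vsucc \<alpha>)"
  unfolding ordinal_def transitive_def by auto

text \<open>Double induction on membership: if the two were incomparable, every element of either
  one would belong to the other, and extensionality would make them equal.\<close>

lemma ordinal_linear:
  fixes \<alpha> \<beta> :: "'v::zfc"
  assumes "ordinal \<alpha>" "ordinal \<beta>"
  shows "\<alpha> \<in> elts \<beta> \<or> \<alpha> = \<beta> \<or> \<beta> \<in> elts \<alpha>"
  using assms
proof (induction \<alpha> arbitrary: \<beta> rule: mem_induct)
  case outer: (mem \<alpha>)
  show ?case using outer.prems(2)
  proof (induction \<beta> rule: mem_induct)
    case inner: (mem \<beta>)
    show ?case
    proof (rule ccontr)
      assume no: "\<not> ?thesis"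
      have "elts \<alpha> \<subseteq> elts \<beta>"
      proof
        fix x assume x: "x \<in> elts \<alpha>"
        then show "x \<in> elts \<beta>"
          using outer.IH[OF x ordinal_mem[OF outer.prems(1) x] inner.prems] no
            ordinal_trans[OF outer.prems(1) x] by blast
      qed
      moreover have "elts \<beta> \<subseteq> elts \<alpha>"
      proof
        fix x assume x: "x \<in> elts \<beta>"
        then show "x \<in> elts \<alpha>"
          using inner.IH[OF x ordinal_mem[OF inner.prems x]] no
            ordinal_trans[OF inner.prems x] by blast
      qed
      ultimately have "\<alpha> = \<beta>" by (metis elts_inject subset_antisym)
      then show False using no by blast
    qed
  qed
qed

section \<open>The stages of the cumulative hierarchy\<close>

lemma Vset_iff: "x \<in> Vset \<alpha> \<longleftrightarrow> (\<exists>\<beta>\<in>elts \<alpha>. elts x \<subseteq> Vset \<beta>)"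
  by (subst Vset.simps) auto

lemma Vset_mono: "elts \<alpha> \<subseteq> elts \<beta> \<Longrightarrow> Vset \<alpha> \<subseteq> Vset \<beta>"
  unfolding subset_iff Vset_iff[of _ \<alpha>] Vset_iff[of _ \<beta>] by blast

lemma Vset_mono_mem: "ordinal \<beta> \<Longrightarrow> \<alpha> \<in> elts \<beta> \<Longrightarrow> Vset \<alpha> \<subseteq> Vset \<beta>"
  by (rule Vset_mono) (auto intro: ordinal_trans)

lemma Vset_trans: "ordinal \<alpha> \<Longrightarrow> x \<in> Vset \<alpha> \<Longrightarrow> elts x \<subseteq> Vset \<alpha>"
  using Vset_iff Vset_mono_mem by blast

lemma Vset_subset_closed: "x \<in> Vset \<alpha> \<Longrightarrow> elts y \<subseteq> elts x \<Longrightarrow> y \<in> Vset \<alpha>"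
  by (meson Vset_iff order_trans)

lemma small_Vset [simp]: "small (Vset \<alpha>)"
proof (induction \<alpha> rule: mem_induct)
  case (mem \<alpha>)
  have "Vset \<alpha> = (\<Union>\<beta>\<in>elts \<alpha>. subsets (vset (Vset \<beta>)))"
    using mem by (subst Vset.simps) (auto simp: subsets_def)
  then show ?case by (auto intro: small_UN)
qed

text \<open>Otherwise \<open>elts \<alpha> \<subseteq> Vset \<beta>\<close> for some \<beta> in
  \<alpha>, which puts \<beta> into \<open>Vset \<beta>\<close> against the induction
  hypothesis.\<close>

lemma notin_Vset_self: "\<alpha> \<notin> Vset \<alpha>"
proof (induction \<alpha> rule: mem_induct)
  case (mem \<alpha>)
  then show ?case unfolding Vset_iff[of \<alpha> \<alpha>] by blast
qed

lemma elts_subset_Vset: "elts \<alpha> \<subseteq> Vset \<alpha>"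
proof (induction \<alpha> rule: mem_induct)
  case (mem \<alpha>)
  then show ?case unfolding subset_iff[of "elts \<alpha>"] Vset_iff[of _ \<alpha>] by blast
qed

text \<open>An ordinal outside \<kappa> includes \<kappa>, so by monotonicity of stages its
  membership in \<open>Vset \<kappa>\<close> would give membership in its own stage.\<close>

lemma ordinal_in_Vset_iff:
  assumes "ordinal \<alpha>" "ordinal \<kappa>"
  shows "\<alpha> \<in> Vset \<kappa> \<longleftrightarrow> \<alpha> \<in> elts \<kappa>"
proof
  assume \<alpha>: "\<alpha> \<in> Vset \<kappa>"
  show "\<alpha> \<in> elts \<kappa>"
  proof (rule ccontr)
    assume "\<alpha> \<notin> elts \<kappa>"
    then have "elts \<kappa> \<subseteq> elts \<alpha>"
      using ordinal_linear[OF assms] ordinal_trans[OF assms(1)] by blast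
    then show False using Vset_mono \<alpha> notin_Vset_self by blast
  qed
qed (use elts_subset_Vset in blast)

section \<open>First properties of inaccessible cardinals\<close>

lemma inaccessible_ordinal: "inaccessible \<kappa> \<Longrightarrow> ordinal \<kappa>"
  by (simp add: inaccessible_def cardinal_def)

text \<open>Otherwise \<kappa> is the successor of \<alpha>; adding one point to an infinite set
  does not change its cardinality, so \<kappa> would not be a cardinal.\<close>

lemma inaccessible_vsucc:
  fixes \<kappa> :: "'v::zfc"
  assumes "inaccessible \<kappa>" "\<alpha> \<in> elts \<kappa>"
  shows "vsucc \<alpha> \<in> elts \<kappa>"
proof (rule ccontr)
  have ord: "ordinal \<kappa>" using assms inaccessible_ordinal by blast
  assume "vsucc \<alpha> \<notin> elts \<kappa>"
  then have "\<kappa> = vsucc \<alpha> \<or> \<kappa> \<in> elts (vsucc \<alpha>)"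
    using ordinal_linear[OF ordinal_vsucc[OF ordinal_mem[OF ord assms(2)]] ord] by blast
  moreover have "\<kappa> \<notin> elts (vsucc \<alpha>)"
    using assms(2) elts_not_sym[OF assms(2)] by auto
  ultimately have \<kappa>: "elts \<kappa> = insert \<alpha> (elts \<alpha>)" by simp
  have "infinite (elts \<kappa>)"
    using assms(1) countable_finite[of "elts \<kappa>"] by (auto simp: inaccessible_def)
  then have "infinite (elts \<alpha>)" by (simp add: \<kappa>)
  then have "elts \<alpha> \<approx> elts \<kappa>"
    unfolding \<kappa> by (rule eqpoll_sym[OF infinite_insert_eqpoll])
  then show False using assms by (auto simp: inaccessible_def cardinal_def)
qed

text \<open>By uncountability some element of \<kappa> is not a numeral, and an ordinal that is not
  a numeral lies above all of them.\<close>

lemma inaccessible_above_num: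
  assumes "inaccessible \<kappa>"
  obtains \<alpha> where "\<alpha> \<in> elts \<kappa>" "range num \<subseteq> elts \<alpha>"
proof -
  have "\<not> elts \<kappa> \<subseteq> range num"
    using assms countable_subset[of "elts \<kappa>" "range num"] by (auto simp: inaccessible_def)
  then obtain \<alpha> where \<alpha>: "\<alpha> \<in> elts \<kappa>" "\<alpha> \<notin> range num" by blast
  have "ordinal \<alpha>" using \<alpha> assms inaccessible_ordinal ordinal_mem by blast
  have "num n \<in> elts \<alpha>" for n
    using ordinal_linear[OF \<open>ordinal \<alpha>\<close> ordinal_num[of n]] \<alpha>(2) by (auto simp: elts_num)
  then show ?thesis using that \<alpha> by blast
qed

section \<open>Closure of inaccessible stages\<close>

definition universe :: "'v::zfc set \<Rightarrow> bool"
  where "universe M \<longleftrightarrow> (\<exists>\<kappa>. inaccessible \<kappa> \<and> M = Vset \<kappa>)"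

lemma universe_trans: "universe M \<Longrightarrow> x \<in> M \<Longrightarrow> y \<in> elts x \<Longrightarrow> y \<in> M"
  by (auto simp: universe_def dest: Vset_trans[OF inaccessible_ordinal])

lemma universe_subset: "universe M \<Longrightarrow> x \<in> M \<Longrightarrow> elts y \<subseteq> elts x \<Longrightarrow> y \<in> M"
  by (auto simp: universe_def intro: Vset_subset_closed)

lemma universe_num_set:
  fixes M :: "'v::zfc set"
  assumes "universe M"
  shows "\<exists>N\<in>M. elts N = range num"
proof -
  from assms obtain \<kappa> where \<kappa>: "inaccessible \<kappa>" "M = Vset \<kappa>" by (auto simp: universe_def)
  obtain \<alpha> where \<alpha>: "\<alpha> \<in> elts \<kappa>" "range num \<subseteq> elts \<alpha>"
    by (rule inaccessible_above_num[OF \<kappa>(1)])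
  have N: "elts (vset (range num) :: 'v) = range num"
    by (rule elts_vset[OF small_subset[OF small_elts \<alpha>(2)]])
  moreover have "vset (range num) \<in> M"
    unfolding \<kappa>(2)
  proof (rule Vset_subset_closed)
    show "\<alpha> \<in> Vset \<kappa>" using \<alpha>(1) elts_subset_Vset by blast
  qed (simp only: N \<alpha>(2))
  ultimately show ?thesis by blast
qed

lemma universe_num: "universe M \<Longrightarrow> num n \<in> M"
  using universe_num_set[of M] universe_trans[of M _ "num n"] by auto

lemma universe_Un: "universe M \<Longrightarrow> x \<in> M \<Longrightarrow> y \<in> M \<Longrightarrow> vset (elts x \<union> elts y) \<in> M"
proof -
  assume "universe M" and xy: "x \<in> M" "y \<in> M"
  then obtain \<kappa> where \<kappa>: "inaccessible \<kappa>" "M = Vset \<kappa>" by (auto simp: universe_def)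
  then have ord: "ordinal \<kappa>" using inaccessible_ordinal by blast
  obtain \<alpha> \<beta> where ab: "\<alpha> \<in> elts \<kappa>" "elts x \<subseteq> Vset \<alpha>" "\<beta> \<in> elts \<kappa>" "elts y \<subseteq> Vset \<beta>"
    using xy by (auto simp: \<kappa> Vset_iff[of _ \<kappa>])
  have "Vset \<alpha> \<subseteq> Vset \<beta> \<or> Vset \<beta> \<subseteq> Vset \<alpha>"
    using ordinal_linear[of \<alpha> \<beta>] ab ordinal_mem[OF ord] Vset_mono_mem by blast
  then have "elts x \<union> elts y \<subseteq> Vset \<alpha> \<or> elts x \<union> elts y \<subseteq> Vset \<beta>" using ab by blast
  then show ?thesis using ab by (auto simp: \<kappa> Vset_iff[of _ \<kappa>] small_Un)
qed

lemma universe_Union: "universe M \<Longrightarrow> x \<in> M \<Longrightarrow> vset (\<Union>y\<in>elts x. elts y) \<in> M"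
proof -
  assume "universe M" and x: "x \<in> M"
  then obtain \<kappa> where \<kappa>: "inaccessible \<kappa>" "M = Vset \<kappa>" by (auto simp: universe_def)
  then have ord: "ordinal \<kappa>" using inaccessible_ordinal by blast
  obtain \<alpha> where \<alpha>: "\<alpha> \<in> elts \<kappa>" "elts x \<subseteq> Vset \<alpha>"
    using x by (auto simp: \<kappa> Vset_iff[of _ \<kappa>])
  have "(\<Union>y\<in>elts x. elts y) \<subseteq> Vset \<alpha>"
    using \<alpha> Vset_trans[OF ordinal_mem[OF ord \<alpha>(1)]] by blast
  moreover have "small (\<Union>y\<in>elts x. elts y)" by (intro small_UN) auto
  ultimately show ?thesis using \<alpha>(1) by (auto simp: \<kappa> Vset_iff[of _ \<kappa>])
qed

lemma universe_Pow: "universe M \<Longrightarrow> x \<in> M \<Longrightarrow> vset (subsets x) \<in> M"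
proof -
  assume "universe M" and x: "x \<in> M"
  then obtain \<kappa> where \<kappa>: "inaccessible \<kappa>" "M = Vset \<kappa>" by (auto simp: universe_def)
  obtain \<alpha> where \<alpha>: "\<alpha> \<in> elts \<kappa>" "elts x \<subseteq> Vset \<alpha>"
    using x by (auto simp: \<kappa> Vset_iff[of _ \<kappa>])
  have "subsets x \<subseteq> Vset (vsucc \<alpha>)"
    using \<alpha>(2) by (force simp: Vset_iff[of _ "vsucc \<alpha>"])
  then show ?thesis
    using inaccessible_vsucc[OF \<kappa>(1) \<alpha>(1)] by (auto simp: \<kappa> Vset_iff[of _ \<kappa>])
qed

lemma universe_stage: "universe M \<Longrightarrow> \<alpha> \<in> M \<Longrightarrow> ordinal \<alpha> \<Longrightarrow> vset (Vset \<alpha>) \<in> M"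
proof -
  assume "universe M" and \<alpha>: "\<alpha> \<in> M" "ordinal \<alpha>"
  then obtain \<kappa> where \<kappa>: "inaccessible \<kappa>" "M = Vset \<kappa>" by (auto simp: universe_def)
  then have "\<alpha> \<in> elts \<kappa>" using \<alpha> ordinal_in_Vset_iff inaccessible_ordinal by blast
  then show ?thesis by (auto simp: \<kappa> Vset_iff[of _ \<kappa>])
qed

lemma universe_Vset: "universe M \<Longrightarrow> \<alpha> \<in> M \<Longrightarrow> ordinal \<alpha> \<Longrightarrow> Vset \<alpha> \<subseteq> M"
  using universe_trans[OF _ universe_stage, of M \<alpha>] by auto

lemma universe_upair: "universe M \<Longrightarrow> x \<in> M \<Longrightarrow> y \<in> M \<Longrightarrow> upair x y \<in> M"
proof -
  assume M: "universe M" and xy: "x \<in> M" "y \<in> M"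
  let ?u = "vset (elts x \<union> elts y)"
  have "elts (upair x y) \<subseteq> elts (vset (subsets ?u))"
    by (auto simp: small_Un)
  then show ?thesis
    using universe_subset[OF M universe_Pow[OF M universe_Un[OF M xy]]] by blast
qed

lemma universe_pair: "universe M \<Longrightarrow> x \<in> M \<Longrightarrow> y \<in> M \<Longrightarrow> pair x y \<in> M"
  by (simp add: pair_def universe_upair)

text \<open>A Kuratowski pair is a set of subsets of the union of \<open>a\<close> and
  \<open>b\<close>, so the double power set of that union covers the product.\<close>

lemma universe_times:
  assumes M: "universe M" and a: "a \<in> M" and b: "b \<in> M"
  obtains c where "c \<in> M" "\<And>x y. x \<in> elts a \<Longrightarrow> y \<in> elts b \<Longrightarrow> pair x y \<in> elts c"
proof
  let ?u = "vset (elts a \<union> elts b)"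
  let ?c = "vset (subsets (vset (subsets ?u)))"
  show "?c \<in> M" by (intro universe_Pow universe_Un M a b)
  show "pair x y \<in> elts ?c" if "x \<in> elts a" "y \<in> elts b" for x y
    using that by (auto simp: pair_def small_Un)
qed

text \<open>The predicate \<open>P\<close> is arbitrary, not just definable: every HOL relation
  between two elements of \<open>M\<close> is itself an element of \<open>M\<close>. Bijections and
  recursion histories are found in \<open>M\<close> this way.\<close>

lemma universe_relation:
  assumes M: "universe M" and a: "a \<in> M" and b: "b \<in> M"
  obtains r where "r \<in> M" "\<And>x y. rel r x y \<longleftrightarrow> x \<in> elts a \<and> y \<in> elts b \<and> P x y"
proof -
  obtain c where c: "c \<in> M" "\<And>x y. x \<in> elts a \<Longrightarrow> y \<in> elts b \<Longrightarrow> pair x y \<in> elts c"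
    by (rule universe_times[OF assms]) blast
  let ?R = "{pair x y | x y. x \<in> elts a \<and> y \<in> elts b \<and> P x y}"
  have sub: "?R \<subseteq> elts c" using c(2) by blast
  then have R: "elts (vset ?R) = ?R" using elts_vset small_subset[OF small_elts] by blast
  have "vset ?R \<in> M" by (rule universe_subset[OF M c(1)]) (simp only: R sub)
  moreover have "rel (vset ?R) x y \<longleftrightarrow> x \<in> elts a \<and> y \<in> elts b \<and> P x y" for x y
    unfolding rel_def R by simp
  ultimately show ?thesis by (rule that)
qed

section \<open>Uniform first-order definability\<close>

text \<open>Bound individual variables count too: renaming acts on them as well and has to be
  injective on free and bound ones together.\<close>

primrec vars :: "fm \<Rightarrow> nat set" where
  "vars (Eq i j) = {i, j}"
| "vars (Mem i j) = {i, j}"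
| "vars (In i j) = {i}"
| "vars (Neg \<phi>) = vars \<phi>"
| "vars (Conj \<phi> \<psi>) = vars \<phi> \<union> vars \<psi>"
| "vars (Forall i \<phi>) = insert i (vars \<phi>)"
| "vars (Forall2 i \<phi>) = vars \<phi>"

primrec rename :: "(nat \<Rightarrow> nat) \<Rightarrow> fm \<Rightarrow> fm" where
  "rename \<rho> (Eq i j) = Eq (\<rho> i) (\<rho> j)"
| "rename \<rho> (Mem i j) = Mem (\<rho> i) (\<rho> j)"
| "rename \<rho> (In i j) = In (\<rho> i) j"
| "rename \<rho> (Neg \<phi>) = Neg (rename \<rho> \<phi>)"
| "rename \<rho> (Conj \<phi> \<psi>) = Conj (rename \<rho> \<phi>) (rename \<rho> \<psi>)"
| "rename \<rho> (Forall i \<phi>) = Forall (\<rho> i) (rename \<rho> \<phi>)"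
| "rename \<rho> (Forall2 i \<phi>) = Forall2 i (rename \<rho> \<phi>)"

lemma finite_vars: "finite (vars \<phi>)"
  by (induction \<phi>) auto

lemma finite_free_vars: "finite (free_vars \<phi>)"
  by (induction \<phi>) auto

lemma first_order_rename [simp]: "first_order (rename \<rho> \<phi>) = first_order \<phi>"
  by (induction \<phi>) auto

lemma sat_rename:
  "inj_on \<rho> (vars \<phi>) \<Longrightarrow> (\<And>i. i \<in> vars \<phi> \<Longrightarrow> s (\<rho> i) = s' i) \<Longrightarrow>
    sat M s S (rename \<rho> \<phi>) = sat M s' S \<phi>"
proof (induction \<phi> arbitrary: s s' S)
  case (Conj \<phi> \<psi>)
  show ?case using Conj.IH[of s s' S] Conj.prems by (auto simp: inj_on_Un)
next
  case (Forall i \<phi>)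
  have "sat M (s(\<rho> i := x)) S (rename \<rho> \<phi>) = sat M (s'(i := x)) S \<phi>" for x
    using Forall.prems by (intro Forall.IH) (auto simp: inj_on_def)
  then show ?case by simp
next
  case (Forall2 i \<phi>)
  have "sat M s (S(i := X)) (rename \<rho> \<phi>) = sat M s' (S(i := X)) \<phi>" for X
    using Forall2.prems by (intro Forall2.IH) auto
  then show ?case by simp
qed auto

lemma first_order_free_set_vars: "first_order \<phi> \<Longrightarrow> free_set_vars \<phi> = {}"
  by (induction \<phi>) auto

text \<open>A single formula must be correct over all inaccessible stages at once, which is what
  allows two stages to be compared. The predicate takes \<open>M\<close> as an argument so that it
  can express unbounded quantifiers.\<close>

definition definable :: "('v::zfc set \<Rightarrow> (nat \<Rightarrow> 'v) \<Rightarrow> bool) \<Rightarrow> bool"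
  where "definable P \<longleftrightarrow> (\<exists>\<phi>. first_order \<phi> \<and>
    (\<forall>M s S. universe M \<longrightarrow> range s \<subseteq> M \<longrightarrow> sat M s S \<phi> = P M s))"

text \<open>The pattern of the later proofs: a notion is replaced by an equivalent built from
  quantifiers that the closure rules recognise, and the equivalence may use the closure properties
  of inaccessible stages.\<close>

lemma definable_cong:
  assumes "definable P"
    and "\<And>M s. universe M \<Longrightarrow> range s \<subseteq> M \<Longrightarrow> P M s = Q M s"
  shows "definable Q"
  using assms unfolding definable_def by meson

lemma definable_eq: "definable (\<lambda>M s. s i = s j)"
  unfolding definable_def by (rule exI[of _ "Eq i j"]) simp

lemma definable_mem: "definable (\<lambda>M s. s i \<in> elts (s j))"
  unfolding definable_def by (rule exI[of _ "Mem i j"]) (simp add: elts_iff)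

lemma definable_not: "definable P \<Longrightarrow> definable (\<lambda>M s. \<not> P M s)"
  unfolding definable_def by (metis first_order.simps(4) sat.simps(4))

lemma definable_conj:
  assumes "definable P" "definable Q"
  shows "definable (\<lambda>M s. P M s \<and> Q M s)"
proof -
  obtain \<phi> \<psi> where "first_order \<phi>" "first_order \<psi>"
    and "\<And>M s S. universe M \<Longrightarrow> range s \<subseteq> M \<Longrightarrow> sat M s S \<phi> = P M s"
    and "\<And>M s S. universe M \<Longrightarrow> range s \<subseteq> M \<Longrightarrow> sat M s S \<psi> = Q M s"
    using assms unfolding definable_def by meson
  then show ?thesis unfolding definable_def by (intro exI[of _ "Conj \<phi> \<psi>"]) simp
qed

lemma definable_disj: "definable P \<Longrightarrow> definable Q \<Longrightarrow> definable (\<lambda>M s. P M s \<or> Q M s)"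
  using definable_not[OF definable_conj[OF definable_not[of P] definable_not[of Q]]] by simp

lemma definable_imp: "definable P \<Longrightarrow> definable Q \<Longrightarrow> definable (\<lambda>M s. P M s \<longrightarrow> Q M s)"
  using definable_disj[OF definable_not[of P], of Q] by (simp only: imp_conv_disj)

lemma definable_iff: "definable P \<Longrightarrow> definable Q \<Longrightarrow> definable (\<lambda>M s. P M s \<longleftrightarrow> Q M s)"
  using definable_conj[OF definable_imp[of P Q] definable_imp[of Q P]]
  by (simp only: iff_conv_conj_imp)

text \<open>In the premise the bound variable is variable 0 and the others are shifted up, so that
  repeated use of the quantifier rules never needs a freshness argument.\<close>

lemma definable_all:
  assumes "definable (\<lambda>M s. Q M (\<lambda>n. s (Suc n)) (s 0))"
  shows "definable (\<lambda>M s. \<forall>x\<in>M. Q M s x)"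
proof -
  obtain \<phi> where \<phi>: "first_order \<phi>"
    "\<And>M s S. universe M \<Longrightarrow> range s \<subseteq> M \<Longrightarrow> sat M s S \<phi> = Q M (\<lambda>n. s (Suc n)) (s 0)"
    using assms unfolding definable_def by (elim exE conjE) simp
  obtain N where N: "\<And>i. i \<in> vars \<phi> \<Longrightarrow> i < N"
    using finite_vars[of \<phi>] unfolding finite_nat_set_iff_bounded by blast
  \<comment> \<open>Undoes the shift: \<open>Suc i\<close> becomes \<open>i\<close> again, while the
    bound variable 0 becomes \<open>N\<close>, which exceeds every variable of \<phi>.\<close>
  define \<rho> where "\<rho> = case_nat N (\<lambda>i. i)"
  have inj: "inj_on \<rho> (vars \<phi>)"
    using N by (fastforce simp: inj_on_def \<rho>_def split: nat.splits)
  have "sat M s S (Forall N (rename \<rho> \<phi>)) = (\<forall>x\<in>M. Q M s x)"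
    if M: "universe M" and s: "range s \<subseteq> M" for M s S
  proof -
    have "sat M (s(N := x)) S (rename \<rho> \<phi>) = Q M s x" if "x \<in> M" for x
    proof -
      have "sat M (s(N := x)) S (rename \<rho> \<phi>) = sat M (case_nat x s) S \<phi>"
        using N by (intro sat_rename inj) (fastforce simp: \<rho>_def split: nat.splits)
      moreover have "range (case_nat x s) \<subseteq> M"
        using range_subsetD[OF s] \<open>x \<in> M\<close> by (auto split: nat.splits)
      ultimately show ?thesis using \<phi>(2)[OF M] by simp
    qed
    then show ?thesis by simp
  qed
  then show ?thesis unfolding definable_def
    using \<phi>(1) by (intro exI[of _ "Forall N (rename \<rho> \<phi>)"]) (simp del: sat.simps)
qed

lemma definable_ex:
  assumes "definable (\<lambda>M s. Q M (\<lambda>n. s (Suc n)) (s 0))"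
  shows "definable (\<lambda>M s. \<exists>x\<in>M. Q M s x)"
  using definable_not[OF definable_all[of "\<lambda>M s x. \<not> Q M s x", OF definable_not[OF assms]]]
  by simp

lemma definable_ball:
  assumes "definable (\<lambda>M s. Q M (\<lambda>n. s (Suc n)) (s 0))"
  shows "definable (\<lambda>M s. \<forall>x\<in>elts (s i). Q M s x)"
proof (rule definable_cong)
  show "definable (\<lambda>M s. \<forall>x\<in>M. x \<in> elts (s i) \<longrightarrow> Q M s x)"
    by (intro definable_all definable_imp definable_mem assms)
  show "(\<forall>x\<in>M. x \<in> elts (s i) \<longrightarrow> Q M s x) = (\<forall>x\<in>elts (s i). Q M s x)"
    if "universe M" "range s \<subseteq> M" for M s
    using that universe_trans[of M "s i"] by blast
qed

lemma definable_bex: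
  assumes "definable (\<lambda>M s. Q M (\<lambda>n. s (Suc n)) (s 0))"
  shows "definable (\<lambda>M s. \<exists>x\<in>elts (s i). Q M s x)"
  using definable_not[OF definable_ball[of "\<lambda>M s x. \<not> Q M s x", OF definable_not[OF assms]]]
  by simp

lemma definable_subset: "definable (\<lambda>M s. elts (s i) \<subseteq> elts (s j))"
  unfolding subset_eq by (intro definable_ball definable_mem)

text \<open>An inaccessible stage contains all subsets of its elements, so this is a quantifier over
  \<open>M\<close>. Here second-order quantification over a smaller stage becomes
  first-order.\<close>

lemma definable_ball_subsets:
  assumes "definable (\<lambda>M s. Q M (\<lambda>n. s (Suc n)) (s 0))"
  shows "definable (\<lambda>M s. \<forall>x\<in>subsets (s i). Q M s x)"
proof (rule definable_cong)
  show "definable (\<lambda>M s. \<forall>x\<in>M. elts x \<subseteq> elts (s i) \<longrightarrow> Q M s x)"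
    by (intro definable_all definable_imp definable_subset assms)
  show "(\<forall>x\<in>M. elts x \<subseteq> elts (s i) \<longrightarrow> Q M s x) = (\<forall>x\<in>subsets (s i). Q M s x)"
    if "universe M" "range s \<subseteq> M" for M s
    using that universe_subset[of M "s i"] range_subsetD[OF that(2), of i]
    unfolding Ball_def in_subsets by blast
qed

lemma definable_bex_subsets:
  assumes "definable (\<lambda>M s. Q M (\<lambda>n. s (Suc n)) (s 0))"
  shows "definable (\<lambda>M s. \<exists>x\<in>subsets (s i). Q M s x)"
  using definable_not[OF definable_ball_subsets[of "\<lambda>M s x. \<not> Q M s x", OF definable_not[OF assms]]]
  by simp

lemmas definable_intros =
  definable_eq definable_mem definable_not definable_conj definable_disj definable_imp
  definable_iff definable_all definable_ex definable_ball definable_bex definable_subset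
  definable_ball_subsets definable_bex_subsets

text \<open>The defining formula may have free variables on whose values its truth does not depend.
  They are bound one by one; since \<open>M\<close> is nonempty, each added quantifier preserves the
  truth value.\<close>

lemma definable_sentence:
  fixes P :: "'v::zfc set \<Rightarrow> bool"
  assumes "definable (\<lambda>M s. P M)"
  obtains \<sigma> where "sentence \<sigma>" "first_order \<sigma>" "\<And>M. universe M \<Longrightarrow> M \<Turnstile> \<sigma> \<longleftrightarrow> P M"
proof -
  have close: "\<exists>\<sigma>. sentence \<sigma> \<and> first_order \<sigma> \<and>
      (\<forall>M s S. universe M \<longrightarrow> range s \<subseteq> M \<longrightarrow> sat M s S \<sigma> = P M)"
    if "first_order \<phi>" "\<forall>M s S. universe M \<longrightarrow> range s \<subseteq> M \<longrightarrow> sat M s S \<phi> = P M" for \<phi>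
    using that
  proof (induction "card (free_vars \<phi>)" arbitrary: \<phi>)
    case 0
    then have "sentence \<phi>"
      by (simp add: sentence_def finite_free_vars first_order_free_set_vars)
    then show ?case using 0 by blast
  next
    case (Suc n)
    then obtain i where i: "i \<in> free_vars \<phi>" by fastforce
    have "n = card (free_vars (Forall i \<phi>))"
      using Suc.hyps(2) i by (simp add: finite_free_vars)
    moreover have "sat M s S (Forall i \<phi>) = P M" if M: "universe M" and s: "range s \<subseteq> M" for M s S
    proof -
      have "range (s(i := x)) \<subseteq> M" if "x \<in> M" for x
        using range_subsetD[OF s] that by auto
      then have "sat M (s(i := x)) S \<phi> = P M" if "x \<in> M" for x
        using Suc.prems(2) M that by blast
      moreover have "s 0 \<in> M" using s by blast
      ultimately show ?thesis by auto
    qed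
    ultimately show ?case using Suc.hyps(1)[of "Forall i \<phi>"] Suc.prems(1) by simp
  qed
  obtain \<phi> where "first_order \<phi>"
    "\<forall>M s S. universe M \<longrightarrow> range s \<subseteq> M \<longrightarrow> sat M s S \<phi> = P M"
    using assms unfolding definable_def by blast
  from close[OF this] obtain \<sigma> where \<sigma>: "sentence \<sigma>" "first_order \<sigma>"
    "\<And>M s (S :: nat \<Rightarrow> 'v set). universe M \<Longrightarrow> range s \<subseteq> M \<Longrightarrow> sat M s S \<sigma> = P M" by blast
  have "M \<Turnstile> \<sigma> \<longleftrightarrow> P M" if M: "universe M" for M
  proof -
    have "range (\<lambda>_. num 0) \<subseteq> M" using universe_num[OF M] by blast
    then have "sat M (\<lambda>_. num 0) (\<lambda>_. {}) \<sigma>" if "M \<Turnstile> \<sigma>"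
      using that by (simp add: models_def)
    then have "P M" if "M \<Turnstile> \<sigma>"
      using that \<sigma>(3)[OF M \<open>range (\<lambda>_. num 0) \<subseteq> M\<close>] by simp
    moreover have "M \<Turnstile> \<sigma>" if "P M"
      using that \<sigma>(3)[OF M] by (simp add: models_def)
    ultimately show ?thesis by blast
  qed
  then show ?thesis using that[OF \<sigma>(1,2)] by simp
qed

text \<open>Preservation of truth in one direction suffices, because it also applies to the sentence
  expressing the negation.\<close>

lemma definable_transfer:
  assumes "definable (\<lambda>M s. P M)" "universe M" "universe M'"
    and "\<And>\<sigma>. sentence \<sigma> \<Longrightarrow> first_order \<sigma> \<Longrightarrow> M \<Turnstile> \<sigma> \<Longrightarrow> M' \<Turnstile> \<sigma>"
  shows "P M \<longleftrightarrow> P M'"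
proof -
  obtain \<sigma> where "sentence \<sigma>" "first_order \<sigma>" "\<And>M. universe M \<Longrightarrow> M \<Turnstile> \<sigma> \<longleftrightarrow> P M"
    by (rule definable_sentence[OF assms(1)]) blast
  moreover obtain \<tau> where "sentence \<tau>" "first_order \<tau>" "\<And>M. universe M \<Longrightarrow> M \<Turnstile> \<tau> \<longleftrightarrow> \<not> P M"
    by (rule definable_sentence[OF definable_not[OF assms(1)]]) blast
  ultimately show ?thesis using assms(2-4) by blast
qed

section \<open>Definability of inaccessible stages\<close>

lemma definable_upair: "definable (\<lambda>M s. s i = upair (s j) (s k))"
proof (rule definable_cong)
  show "definable (\<lambda>M s. (\<forall>z\<in>elts (s i). z = s j \<or> z = s k) \<and> s j \<in> elts (s i) \<and> s k \<in> elts (s i))"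
    by (intro definable_intros)
qed (auto simp: upair_eq_iff)

lemma definable_pair: "definable (\<lambda>M s. s i = pair (s j) (s k))"
proof (rule definable_cong)
  show "definable (\<lambda>M s. (\<forall>z\<in>elts (s i). z = upair (s j) (s j) \<or> z = upair (s j) (s k)) \<and>
      (\<exists>z\<in>elts (s i). z = upair (s j) (s j)) \<and> (\<exists>z\<in>elts (s i). z = upair (s j) (s k)))"
    by (intro definable_intros definable_upair)
qed (auto simp: pair_def upair_eq_iff[of "_ _"])

lemma definable_rel: "definable (\<lambda>M s. rel (s i) (s j) (s k))"
proof (rule definable_cong)
  show "definable (\<lambda>M s. \<exists>p\<in>elts (s i). p = pair (s j) (s k))"
    by (intro definable_intros definable_pair)
qed (auto simp: rel_def)

lemma eq_vset_iff: "small X \<Longrightarrow> x = vset X \<longleftrightarrow> elts x = X"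
  by (metis elts_inject elts_vset)

lemma vsucc_eq_iff: "y = vsucc x \<longleftrightarrow> elts y = insert x (elts x)"
  by (metis elts_inject elts_vsucc)

lemma definable_vsucc: "definable (\<lambda>M s. s i = vsucc (s j))"
proof (rule definable_cong)
  show "definable (\<lambda>M s. (\<forall>z\<in>elts (s i). z = s j \<or> z \<in> elts (s j)) \<and>
      s j \<in> elts (s i) \<and> elts (s j) \<subseteq> elts (s i))"
    by (intro definable_intros)
  show "((\<forall>z\<in>elts (s i). z = s j \<or> z \<in> elts (s j)) \<and>
      s j \<in> elts (s i) \<and> elts (s j) \<subseteq> elts (s i)) = (s i = vsucc (s j))" for s :: "nat \<Rightarrow> 'a"
    by (auto simp: vsucc_eq_iff)
qed

lemma definable_num: "definable (\<lambda>M (s :: nat \<Rightarrow> 'v::zfc). s i = num k)"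
proof (induction k arbitrary: i)
  case 0
  have "definable (\<lambda>M (s :: nat \<Rightarrow> 'v). \<forall>z\<in>elts (s i). z \<noteq> z)"
    by (intro definable_intros)
  then show ?case
    by (rule definable_cong) (auto simp: eq_vset_iff)
next
  case (Suc k)
  have "definable (\<lambda>M (s :: nat \<Rightarrow> 'v). \<exists>y\<in>elts (s i). y = num k \<and> s i = vsucc y)"
    by (intro definable_intros definable_vsucc Suc)
  then show ?case by (rule definable_cong) auto
qed

text \<open>The set of numerals is the only inductive set without a proper inductive subset.\<close>

lemma definable_nums: "definable (\<lambda>M (s :: nat \<Rightarrow> 'v::zfc). elts (s i) = range num)"
proof (rule definable_cong)
  let ?ind = "\<lambda>N :: 'v. (\<exists>z\<in>elts N. z = num 0) \<and> (\<forall>y\<in>elts N. \<exists>z\<in>elts N. z = vsucc y)"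
  show "definable (\<lambda>M s. ?ind (s i) \<and> (\<forall>N\<in>subsets (s i). ?ind N \<longrightarrow> N = s i))"
    by (intro definable_intros definable_vsucc definable_num)
  have sub: "range num \<subseteq> elts N" if "?ind N" for N
  proof -
    have "num n \<in> elts N" for n using that by (induction n) auto
    then show ?thesis by blast
  qed
  have ind: "?ind N" if N: "elts N = range num" for N
    unfolding N by (auto simp: image_iff simp flip: num.simps)
  show "(?ind (s i) \<and> (\<forall>N\<in>subsets (s i). ?ind N \<longrightarrow> N = s i)) = (elts (s i) = range num)"
    for s :: "nat \<Rightarrow> 'v"
  proof
    assume L: "?ind (s i) \<and> (\<forall>N\<in>subsets (s i). ?ind N \<longrightarrow> N = s i)"
    then have r: "range num \<subseteq> elts (s i)" using sub by blast
    have N: "elts (vset (range num) :: 'v) = range num"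
      by (rule elts_vset[OF small_subset[OF small_elts r]])
    then have "vset (range num) = s i"
      using bspec[OF conjunct2[OF L], of "vset (range num)"] ind[OF N] N r by auto
    then show "elts (s i) = range num" using N by simp
  next
    assume R: "elts (s i) = range num"
    have "N = s i" if "N \<in> subsets (s i)" "?ind N" for N
    proof -
      have "elts N = elts (s i)" using sub[OF that(2)] that(1) R by auto
      then show ?thesis by simp
    qed
    then show "?ind (s i) \<and> (\<forall>N\<in>subsets (s i). ?ind N \<longrightarrow> N = s i)"
      using ind[OF R] by blast
  qed
qed

text \<open>A relation with exactly one entry in each row and each column is the graph of a
  bijection, and by \<open>universe_relation\<close> every such graph is in \<open>M\<close>. Hence
  \<open>M\<close> computes equipollence correctly.\<close>

lemma eqpoll_iff_rel:
  assumes M: "universe M" and ab: "a \<in> M" "b \<in> M"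
  shows "elts a \<approx> elts b \<longleftrightarrow> (\<exists>r\<in>M.
    (\<forall>x\<in>elts a. \<exists>y\<in>elts b. \<forall>z\<in>elts b. rel r x z \<longleftrightarrow> z = y) \<and>
    (\<forall>y\<in>elts b. \<exists>x\<in>elts a. \<forall>z\<in>elts a. rel r z y \<longleftrightarrow> z = x))" (is "_ \<longleftrightarrow> ?R")
proof
  assume "elts a \<approx> elts b"
  then obtain h where h: "bij_betw h (elts a) (elts b)" by (auto simp: eqpoll_def)
  obtain r where r: "r \<in> M" "\<And>x y. rel r x y \<longleftrightarrow> x \<in> elts a \<and> y \<in> elts b \<and> y = h x"
    by (rule universe_relation[OF M ab, of "\<lambda>x y. y = h x"]) blast
  have "\<exists>y\<in>elts b. \<forall>z\<in>elts b. rel r x z \<longleftrightarrow> z = y" if "x \<in> elts a" for x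
    using that bij_betwE[OF h] by (intro bexI[of _ "h x"]) (auto simp: r(2))
  moreover have "\<exists>x\<in>elts a. \<forall>z\<in>elts a. rel r z y \<longleftrightarrow> z = x" if "y \<in> elts b" for y
  proof -
    obtain x where x: "x \<in> elts a" "y = h x"
      using \<open>y \<in> elts b\<close> h by (auto simp: bij_betw_def)
    then show ?thesis using h \<open>y \<in> elts b\<close>
      by (intro bexI[of _ x]) (auto simp: r(2) bij_betw_def inj_on_def)
  qed
  ultimately show ?R using r(1) by blast
next
  assume ?R
  then obtain r where r: "\<And>x. x \<in> elts a \<Longrightarrow> \<exists>y\<in>elts b. \<forall>z\<in>elts b. rel r x z \<longleftrightarrow> z = y"
    "\<And>y. y \<in> elts b \<Longrightarrow> \<exists>x\<in>elts a. \<forall>z\<in>elts a. rel r z y \<longleftrightarrow> z = x" by blast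
  from r(1) obtain h where h: "\<And>x. x \<in> elts a \<Longrightarrow> h x \<in> elts b"
    "\<And>x z. x \<in> elts a \<Longrightarrow> z \<in> elts b \<Longrightarrow> rel r x z \<longleftrightarrow> z = h x" by metis
  have "bij_betw h (elts a) (elts b)"
  proof (rule bij_betw_imageI)
    show "inj_on h (elts a)"
    proof (rule inj_onI)
      fix x x' assume x: "x \<in> elts a" "x' \<in> elts a" "h x = h x'"
      \<comment> \<open>The column of \<open>h x\<close> has the single entry \<open>w\<close>, and
        both \<open>x\<close> and \<open>x'\<close> are entries of it.\<close>
      obtain w where "\<forall>z\<in>elts a. rel r z (h x) \<longleftrightarrow> z = w" using r(2)[OF h(1)[OF x(1)]] by blast
      then show "x = x'" using x h by metis
    qed
    show "h ` elts a = elts b"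
    proof
      show "elts b \<subseteq> h ` elts a"
      proof
        fix y assume y: "y \<in> elts b"
        then obtain x where "x \<in> elts a" "rel r x y" using r(2) by blast
        then show "y \<in> h ` elts a" using h(2) y by blast
      qed
    qed (use h(1) in blast)
  qed
  then show "elts a \<approx> elts b" by (auto simp: eqpoll_def)
qed

lemma definable_eqpoll: "definable (\<lambda>M s. elts (s i) \<approx> elts (s j))"
proof (rule definable_cong)
  show "definable (\<lambda>M s. \<exists>r\<in>M.
    (\<forall>x\<in>elts (s i). \<exists>y\<in>elts (s j). \<forall>z\<in>elts (s j). rel r x z \<longleftrightarrow> z = y) \<and>
    (\<forall>y\<in>elts (s j). \<exists>x\<in>elts (s i). \<forall>z\<in>elts (s i). rel r z y \<longleftrightarrow> z = x))"
    by (intro definable_intros definable_rel)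
qed (simp add: eqpoll_iff_rel range_subsetD)

lemma definable_lepoll: "definable (\<lambda>M s. elts (s i) \<lesssim> elts (s j))"
proof (rule definable_cong)
  show "definable (\<lambda>M s. \<exists>c\<in>subsets (s j). elts (s i) \<approx> elts c)"
    by (intro definable_intros definable_eqpoll)
  show "(\<exists>c\<in>subsets (s j). elts (s i) \<approx> elts c) = (elts (s i) \<lesssim> elts (s j))" for s :: "nat \<Rightarrow> 'a"
  proof
    assume "elts (s i) \<lesssim> elts (s j)"
    then obtain C where C: "C \<subseteq> elts (s j)" "elts (s i) \<approx> C"
      by (auto simp: eqpoll_def lepoll_def dest: inj_on_imp_bij_betw)
    then have "elts (vset C) = C" by (intro elts_vset small_subset[OF small_elts])
    then show "\<exists>c\<in>subsets (s j). elts (s i) \<approx> elts c"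
      using C by (intro bexI[of _ "vset C"]) auto
  next
    assume "\<exists>c\<in>subsets (s j). elts (s i) \<approx> elts c"
    then show "elts (s i) \<lesssim> elts (s j)"
      by (meson eqpoll_imp_lepoll in_subsets lepoll_trans subset_imp_lepoll)
  qed
qed

section \<open>The defining conditions of inaccessibility\<close>

lemma definable_ordinal: "definable (\<lambda>M s. ordinal (s i))"
  unfolding ordinal_def transitive_def by (intro definable_intros)

lemma definable_cardinal: "definable (\<lambda>M s. cardinal (s i))"
  unfolding cardinal_def by (intro definable_intros definable_ordinal definable_eqpoll)

lemma definable_uncountable: "definable (\<lambda>M (s :: nat \<Rightarrow> 'v::zfc). uncountable (elts (s i)))"
proof (rule definable_cong)
  show "definable (\<lambda>M (s :: nat \<Rightarrow> 'v). \<exists>N\<in>M. elts N = range num \<and> \<not> elts (s i) \<lesssim> elts N)"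
    by (intro definable_intros definable_nums definable_lepoll)
  have eq: "(UNIV :: nat set) \<approx> range (num :: nat \<Rightarrow> 'v)"
    unfolding eqpoll_def by (auto intro!: exI[of _ num] bij_betw_imageI inj_onI)
  have countable: "X \<lesssim> range (num :: nat \<Rightarrow> 'v) \<longleftrightarrow> countable X" for X :: "'v set"
  proof -
    have "X \<lesssim> range (num :: nat \<Rightarrow> 'v) \<longleftrightarrow> X \<lesssim> (UNIV :: nat set)"
      using lepoll_trans2[OF _ eq] lepoll_trans2[OF _ eqpoll_sym[OF eq]] by blast
    then show ?thesis by (simp add: countable_def lepoll_def)
  qed
  show "(\<exists>N\<in>M. elts N = range num \<and> \<not> elts (s i) \<lesssim> elts N) = uncountable (elts (s i))"
    if M: "universe M" for M :: "'v set" and s :: "nat \<Rightarrow> 'v"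
  proof -
    obtain N where N: "N \<in> M" "elts N = range num" using universe_num_set[OF M] by blast
    have "(\<exists>N\<in>M. elts N = range num \<and> \<not> elts (s i) \<lesssim> elts N) \<longleftrightarrow>
        (\<exists>N\<in>M. elts N = range num \<and> uncountable (elts (s i)))"
      by (rule bex_cong[OF refl], rule conj_cong[OF refl]) (simp only: countable)
    also have "\<dots> \<longleftrightarrow> uncountable (elts (s i))" using N by blast
    finally show ?thesis .
  qed
qed

text \<open>Exchanges HOL subsets, as they occur in the definitions of regularity and strong limits,
  for elements of the universe, over which formulas can quantify.\<close>

lemma elts_image_subsets: "elts ` subsets x = Pow (elts x)"
proof
  show "Pow (elts x) \<subseteq> elts ` subsets x"
  proof
    fix A assume "A \<in> Pow (elts x)"
    then have "A = elts (vset A)" "A \<subseteq> elts x"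
      using elts_vset[OF small_subset[OF small_elts]] by auto
    then show "A \<in> elts ` subsets x" by (intro image_eqI[of _ _ "vset A"]) auto
  qed
qed auto

lemma definable_regular: "definable (\<lambda>M (s :: nat \<Rightarrow> 'v::zfc). regular (s i))"
proof (rule definable_cong)
  show "definable (\<lambda>M s. \<forall>a\<in>subsets (s i).
      (\<forall>\<alpha>\<in>elts (s i). \<exists>\<beta>\<in>elts a. \<alpha> = \<beta> \<or> \<alpha> \<in> elts \<beta>) \<longrightarrow> elts a \<approx> elts (s i))"
    by (intro definable_intros definable_eqpoll)
  show "(\<forall>a\<in>subsets \<kappa>.
      (\<forall>\<alpha>\<in>elts \<kappa>. \<exists>\<beta>\<in>elts a. \<alpha> = \<beta> \<or> \<alpha> \<in> elts \<beta>) \<longrightarrow> elts a \<approx> elts \<kappa>) = regular \<kappa>"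
    for \<kappa> :: 'v
  proof -
    have "(\<forall>a\<in>subsets \<kappa>. Q (elts a)) \<longleftrightarrow> (\<forall>A\<subseteq>elts \<kappa>. Q A)" for Q
      using ball_simps(9)[of elts "subsets \<kappa>" Q] by (simp add: elts_image_subsets Ball_def)
    then show ?thesis unfolding regular_def elts_iff[symmetric] .
  qed
qed

lemma definable_strong_limit: "definable (\<lambda>M (s :: nat \<Rightarrow> 'v::zfc). strong_limit (s i))"
proof (rule definable_cong)
  \<comment> \<open>The first two conjuncts make \<open>p\<close> the power set of \<alpha>, which
    belongs to \<open>M\<close>.\<close>
  show "definable (\<lambda>M s. \<forall>\<alpha>\<in>elts (s i). \<exists>p\<in>M. (\<forall>z\<in>elts p. elts z \<subseteq> elts \<alpha>) \<and>
      (\<forall>z\<in>subsets \<alpha>. z \<in> elts p) \<and> elts p \<lesssim> elts (s i) \<and> \<not> elts p \<approx> elts (s i))"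
    by (intro definable_intros definable_eqpoll definable_lepoll)
  show "(\<forall>\<alpha>\<in>elts (s i). \<exists>p\<in>M. (\<forall>z\<in>elts p. elts z \<subseteq> elts \<alpha>) \<and>
      (\<forall>z\<in>subsets \<alpha>. z \<in> elts p) \<and> elts p \<lesssim> elts (s i) \<and> \<not> elts p \<approx> elts (s i)) =
      strong_limit (s i)"
    if M: "universe M" and s: "range s \<subseteq> M" for M :: "'v set" and s
  proof -
    have p: "(\<forall>z\<in>elts p. elts z \<subseteq> elts \<alpha>) \<and> (\<forall>z\<in>subsets \<alpha>. z \<in> elts p) \<longleftrightarrow> p = vset (subsets \<alpha>)"
      for p \<alpha> :: 'v
      unfolding eq_vset_iff[OF small_subsets] by auto
    have "bij_betw elts (subsets \<alpha>) (Pow (elts \<alpha>))" for \<alpha> :: 'v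
      by (auto simp: bij_betw_def inj_on_def elts_image_subsets)
    then have eq: "subsets \<alpha> \<approx> Pow (elts \<alpha>)" for \<alpha> :: 'v
      unfolding eqpoll_def by blast
    have "Pow (elts \<alpha>) \<prec> X \<longleftrightarrow> subsets \<alpha> \<lesssim> X \<and> \<not> subsets \<alpha> \<approx> X" for \<alpha> :: 'v and X :: "'v set"
      unfolding lesspoll_def
      using lepoll_trans1[OF eq[of \<alpha>]] lepoll_trans1[OF eqpoll_sym[OF eq[of \<alpha>]]]
        eqpoll_trans[OF eq[of \<alpha>]] eqpoll_trans[OF eqpoll_sym[OF eq[of \<alpha>]]] by blast
    moreover have "vset (subsets \<alpha>) \<in> M" if "\<alpha> \<in> elts (s i)" for \<alpha>
      using universe_Pow[OF M universe_trans[OF M range_subsetD[OF s] that]] .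
    ultimately show ?thesis
      unfolding strong_limit_def conj_assoc[symmetric] p by auto
  qed
qed

lemma definable_inaccessible: "definable (\<lambda>M s. inaccessible (s i))"
  unfolding inaccessible_def
  by (intro definable_intros definable_cardinal definable_uncountable definable_regular
      definable_strong_limit)

text \<open>The recursion for stages is expressed by a history \<open>h\<close>, whose section at
  \<beta> is \<open>Vset \<beta>\<close>. Its first clause is the recursion equation below \<gamma>
  and determines the sections by induction; the second computes the stage at \<gamma> from
  them.\<close>

lemma definable_stage: "definable (\<lambda>M s. ordinal (s j) \<and> elts (s i) = Vset (s j))"
proof (rule definable_cong)
  let ?h = "\<lambda>M h x \<gamma>. (\<forall>\<beta>\<in>elts \<gamma>. \<forall>y\<in>M. rel h \<beta> y \<longleftrightarrow> (\<exists>\<alpha>\<in>elts \<beta>. \<forall>z\<in>elts y. rel h \<alpha> z)) \<and>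
    (\<forall>y\<in>M. y \<in> elts x \<longleftrightarrow> (\<exists>\<alpha>\<in>elts \<gamma>. \<forall>z\<in>elts y. rel h \<alpha> z))"
  show "definable (\<lambda>M s. ordinal (s j) \<and> (\<exists>h\<in>M. ?h M h (s i) (s j)))"
    by (intro definable_intros definable_ordinal definable_rel)
  show "(ordinal (s j) \<and> (\<exists>h\<in>M. ?h M h (s i) (s j))) = (ordinal (s j) \<and> elts (s i) = Vset (s j))"
    if M: "universe M" and s: "range s \<subseteq> M" for M :: "'a set" and s
  proof (rule conj_cong[OF refl])
    define \<gamma> x where "\<gamma> = s j" and "x = s i"
    assume "ordinal (s j)"
    then have ord: "ordinal \<gamma>" by (simp add: \<gamma>_def)
    have in_M: "\<gamma> \<in> M" "x \<in> M" using range_subsetD[OF s] by (auto simp: \<gamma>_def x_def)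
    have Vs: "Vset \<beta> \<subseteq> M" if "\<beta> \<in> elts \<gamma>" for \<beta>
      using Vset_mono_mem[OF ord that] universe_Vset[OF M in_M(1) ord] by blast
    have "(\<exists>h\<in>M. ?h M h x \<gamma>) \<longleftrightarrow> elts x = Vset \<gamma>"
    proof
      assume "\<exists>h\<in>M. ?h M h x \<gamma>"
      then obtain h where h: "h \<in> M" "?h M h x \<gamma>" by blast
      have hV: "\<beta> \<in> elts \<gamma> \<longrightarrow> (\<forall>y\<in>M. rel h \<beta> y \<longleftrightarrow> y \<in> Vset \<beta>)" for \<beta>
      proof (induction \<beta> rule: mem_induct)
        case (mem \<beta>)
        show ?case
        proof (intro impI ballI)
          fix y assume \<beta>: "\<beta> \<in> elts \<gamma>" and y: "y \<in> M"
          have "(\<forall>z\<in>elts y. rel h \<alpha> z) \<longleftrightarrow> elts y \<subseteq> Vset \<alpha>" if "\<alpha> \<in> elts \<beta>" for \<alpha>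
            using mem[OF that] ordinal_trans[OF ord \<beta> that] universe_trans[OF M y] by blast
          then show "rel h \<beta> y \<longleftrightarrow> y \<in> Vset \<beta>"
            using h(2) \<beta> y unfolding Vset_iff[of y \<beta>] by blast
        qed
      qed
      have "y \<in> elts x \<longleftrightarrow> y \<in> Vset \<gamma>" if y: "y \<in> M" for y
      proof -
        have "(\<forall>z\<in>elts y. rel h \<alpha> z) \<longleftrightarrow> elts y \<subseteq> Vset \<alpha>" if "\<alpha> \<in> elts \<gamma>" for \<alpha>
          using hV that universe_trans[OF M y] by blast
        then show ?thesis using h(2) y unfolding Vset_iff[of y \<gamma>] by blast
      qed
      then show "elts x = Vset \<gamma>"
        using universe_trans[OF M in_M(2)] universe_Vset[OF M in_M(1) ord] by blast
    next
      assume x: "elts x = Vset \<gamma>"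
      \<comment> \<open>Restricting the second coordinate to \<open>x\<close> loses nothing, since
        all earlier stages are included in \<open>Vset \<gamma>\<close>.\<close>
      obtain h where h: "h \<in> M" "\<And>\<beta> y. rel h \<beta> y \<longleftrightarrow> \<beta> \<in> elts \<gamma> \<and> y \<in> elts x \<and> y \<in> Vset \<beta>"
        by (rule universe_relation[OF M in_M, of "\<lambda>\<beta> y. y \<in> Vset \<beta>"]) blast
      have h': "rel h \<beta> y \<longleftrightarrow> y \<in> Vset \<beta>" if "\<beta> \<in> elts \<gamma>" for \<beta> y
        using that h(2) x Vset_mono_mem[OF ord that] by blast
      have sub: "(\<forall>z\<in>elts y. rel h \<alpha> z) \<longleftrightarrow> elts y \<subseteq> Vset \<alpha>" if "\<alpha> \<in> elts \<gamma>" for \<alpha> y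
        using h'[OF that] by auto
      have "rel h \<beta> y \<longleftrightarrow> (\<exists>\<alpha>\<in>elts \<beta>. \<forall>z\<in>elts y. rel h \<alpha> z)" if \<beta>: "\<beta> \<in> elts \<gamma>" for \<beta> y
        unfolding h'[OF \<beta>] Vset_iff[of y \<beta>]
        by (rule bex_cong[OF refl]) (simp add: sub[OF ordinal_trans[OF ord \<beta>]])
      moreover have "y \<in> elts x \<longleftrightarrow> (\<exists>\<alpha>\<in>elts \<gamma>. \<forall>z\<in>elts y. rel h \<alpha> z)" for y
        unfolding x Vset_iff[of y \<gamma>] by (rule bex_cong[OF refl]) (simp add: sub)
      ultimately show "\<exists>h\<in>M. ?h M h x \<gamma>" by (intro bexI[OF _ h(1)]) simp
    qed
    then show "(\<exists>h\<in>M. ?h M h (s i) (s j)) = (elts (s i) = Vset (s j))"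
      by (simp add: \<gamma>_def x_def)
  qed
qed

section \<open>Codes for second-order formulas\<close>

text \<open>An assignment over a set \<open>x\<close> is a subset \<open>f\<close> of \<open>x\<close>, read as a relation
  between variable names and elements: the value of the variable \<open>a\<close> is the set of all \<open>y\<close>
  with \<open>rel f a y\<close>, and an individual is represented by its singleton. The individual variable
  \<open>i\<close> of \<open>fm\<close> is named \<open>num (2 * i)\<close>, the set variable \<open>j\<close> is named \<open>num (2 * j + 1)\<close>.\<close>

definition meet :: "'v::zfc \<Rightarrow> 'v \<Rightarrow> 'v \<Rightarrow> 'v \<Rightarrow> bool"
  where "meet x a b f \<longleftrightarrow> (\<exists>y\<in>elts x. rel f a y \<and> rel f b y)"

definition below :: "'v::zfc \<Rightarrow> 'v \<Rightarrow> 'v \<Rightarrow> 'v \<Rightarrow> bool"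
  where "below x a b f \<longleftrightarrow> (\<exists>y\<in>elts x. \<exists>z\<in>elts x. rel f a y \<and> rel f b z \<and> y \<in> elts z)"

definition single :: "'v::zfc \<Rightarrow> 'v \<Rightarrow> 'v \<Rightarrow> bool"
  where "single x a f \<longleftrightarrow> (\<exists>y\<in>elts x. \<forall>z\<in>elts x. rel f a z \<longleftrightarrow> z = y)"

definition agree :: "'v::zfc \<Rightarrow> 'v \<Rightarrow> 'v \<Rightarrow> 'v \<Rightarrow> bool"
  where "agree x a f g \<longleftrightarrow> (\<forall>b\<in>elts x. b \<noteq> a \<longrightarrow> (\<forall>y\<in>elts x. rel g b y \<longleftrightarrow> rel f b y))"

text \<open>With individuals coded as singletons, \<open>Meet\<close> serves for equality and for
  \<open>In\<close>, and one quantifier over assignments serves both sorts, relativised by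
  \<open>Single\<close> for individuals. Few constructors mean few clauses in
  \<open>closed_family\<close>.\<close>

datatype code = Meet nat nat | Below nat nat | Single nat | Nand code code | All nat code

primrec holds :: "'v::zfc \<Rightarrow> code \<Rightarrow> 'v \<Rightarrow> bool" where
  "holds x (Meet k l) f \<longleftrightarrow> meet x (num k) (num l) f"
| "holds x (Below k l) f \<longleftrightarrow> below x (num k) (num l) f"
| "holds x (Single k) f \<longleftrightarrow> single x (num k) f"
| "holds x (Nand t u) f \<longleftrightarrow> \<not> (holds x t f \<and> holds x u f)"
| "holds x (All k t) f \<longleftrightarrow> (\<forall>g\<in>subsets x. agree x (num k) f g \<longrightarrow> holds x t g)"

primrec code_of :: "fm \<Rightarrow> code" where
  "code_of (Eq i j) = Meet (2 * i) (2 * j)"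
| "code_of (Mem i j) = Below (2 * i) (2 * j)"
| "code_of (In i j) = Meet (2 * i) (2 * j + 1)"
| "code_of (Neg \<phi>) = Nand (code_of \<phi>) (code_of \<phi>)"
| "code_of (Conj \<phi> \<psi>) =
    Nand (Nand (code_of \<phi>) (code_of \<psi>)) (Nand (code_of \<phi>) (code_of \<psi>))"
| "code_of (Forall i \<phi>) =
    All (2 * i) (Nand (Single (2 * i)) (Nand (code_of \<phi>) (code_of \<phi>)))"
| "code_of (Forall2 j \<phi>) = All (2 * j + 1) (code_of \<phi>)"

text \<open>An inaccessible stage is closed under pairs, so the changed assignment is again a subset
  of \<open>x\<close>, even when its new value \<open>Y\<close> is as large as
  \<open>x\<close>.\<close>

lemma assignment_update:
  assumes x: "universe (elts x)" and a: "a \<in> elts x"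
  shows "\<exists>g\<in>subsets x. agree x a f g \<and> (\<forall>z\<in>elts x. rel g a z \<longleftrightarrow> z \<in> Y)"
proof -
  let ?G = "{pair b z | b z. b \<in> elts x \<and> z \<in> elts x \<and> (if b = a then z \<in> Y else rel f b z)}"
  have sub: "?G \<subseteq> elts x" using universe_pair[OF x] by blast
  have G: "elts (vset ?G) = ?G" by (rule elts_vset[OF small_subset[OF small_elts sub]])
  have r: "rel (vset ?G) b z \<longleftrightarrow>
      b \<in> elts x \<and> z \<in> elts x \<and> (if b = a then z \<in> Y else rel f b z)" for b z
    unfolding rel_def[of "vset ?G"] G by simp
  show ?thesis
  proof (intro bexI conjI ballI)
    show "vset ?G \<in> subsets x" using sub by (simp only: in_subsets G)
    show "agree x a f (vset ?G)" unfolding agree_def r by simp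
    show "rel (vset ?G) a z \<longleftrightarrow> z \<in> Y" if "z \<in> elts x" for z
      using that a unfolding r by simp
  qed
qed

text \<open>By \<open>assignment_update\<close> every individual and every subset of
  \<open>x\<close> occurs as a value at the quantified name. Only free variables are constrained,
  which leaves \<open>f\<close> arbitrary when \<phi> is a sentence.\<close>

lemma holds_code_of:
  fixes x :: "'v::zfc"
  assumes x: "universe (elts x)" and "f \<in> subsets x"
    and "\<And>i. i \<in> free_vars \<phi> \<Longrightarrow> s i \<in> elts x \<and> (\<forall>y\<in>elts x. rel f (num (2 * i)) y \<longleftrightarrow> y = s i)"
    and "\<And>j. j \<in> free_set_vars \<phi> \<Longrightarrow>
      S j \<subseteq> elts x \<and> (\<forall>y\<in>elts x. rel f (num (2 * j + 1)) y \<longleftrightarrow> y \<in> S j)"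
  shows "holds x (code_of \<phi>) f \<longleftrightarrow> sat (elts x) s S \<phi>"
  using assms(2-4)
proof (induction \<phi> arbitrary: f s S)
  case (Eq i j)
  have "s i \<in> elts x" "s j \<in> elts x" "\<forall>y\<in>elts x. rel f (num (2 * i)) y \<longleftrightarrow> y = s i"
    "\<forall>y\<in>elts x. rel f (num (2 * j)) y \<longleftrightarrow> y = s j"
    using Eq.prems(2)[of i] Eq.prems(2)[of j] by simp_all
  then show ?case by (auto simp: meet_def)
next
  case (Mem i j)
  have "s i \<in> elts x" "s j \<in> elts x" "\<forall>y\<in>elts x. rel f (num (2 * i)) y \<longleftrightarrow> y = s i"
    "\<forall>y\<in>elts x. rel f (num (2 * j)) y \<longleftrightarrow> y = s j"
    using Mem.prems(2)[of i] Mem.prems(2)[of j] by simp_all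
  then show ?case by (auto simp: below_def elts_iff[symmetric])
next
  case (In i j)
  have "s i \<in> elts x" "\<forall>y\<in>elts x. rel f (num (2 * i)) y \<longleftrightarrow> y = s i"
    "S j \<subseteq> elts x" "\<forall>y\<in>elts x. rel f (num (2 * j + 1)) y \<longleftrightarrow> y \<in> S j"
    using In.prems(2)[of i] In.prems(3)[of j] by simp_all
  then show ?case by (auto simp: meet_def)
next
  case (Neg \<phi>)
  have "holds x (code_of \<phi>) f \<longleftrightarrow> sat (elts x) s S \<phi>"
    using Neg.prems by (intro Neg.IH) simp_all
  then show ?case by simp
next
  case (Conj \<phi> \<psi>)
  have "holds x (code_of \<phi>) f \<longleftrightarrow> sat (elts x) s S \<phi>"
    using Conj.prems by (intro Conj.IH(1)) simp_all
  moreover have "holds x (code_of \<psi>) f \<longleftrightarrow> sat (elts x) s S \<psi>"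
    using Conj.prems by (intro Conj.IH(2)) simp_all
  ultimately show ?case by simp
next
  case (Forall i \<phi>)
  have IH: "holds x (code_of \<phi>) g \<longleftrightarrow> sat (elts x) (s(i := y)) S \<phi>"
    if g: "g \<in> subsets x" "agree x (num (2 * i)) f g" "y \<in> elts x"
      "\<forall>z\<in>elts x. rel g (num (2 * i)) z \<longleftrightarrow> z = y" for g y
  proof (rule Forall.IH[OF g(1)])
    have ag: "rel g (num k) z \<longleftrightarrow> rel f (num k) z" if "k \<noteq> 2 * i" "z \<in> elts x" for k z
    proof -
      have "num k \<noteq> (num (2 * i) :: 'v)" using that(1) unfolding num_inject .
      then show ?thesis
        using g(2) that(2) universe_num[OF x, of k] unfolding agree_def by blast
    qed
    fix j
    show "(s(i := y)) j \<in> elts x \<and> (\<forall>z\<in>elts x. rel g (num (2 * j)) z \<longleftrightarrow> z = (s(i := y)) j)"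
      if "j \<in> free_vars \<phi>"
      using g(3,4) ag[of "2 * j"] Forall.prems(2)[of j] that by (cases "j = i") auto
    \<comment> \<open>Parity separates the two sorts of names, so changing an individual leaves
      every set value intact.\<close>
    have "2 * j + 1 \<noteq> 2 * i" by presburger
    then show "S j \<subseteq> elts x \<and> (\<forall>y\<in>elts x. rel g (num (2 * j + 1)) y \<longleftrightarrow> y \<in> S j)"
      if "j \<in> free_set_vars \<phi>"
      using ag[of "2 * j + 1"] Forall.prems(3)[of j] that by simp
  qed
  have "holds x (code_of (Forall i \<phi>)) f \<longleftrightarrow> (\<forall>g\<in>subsets x. agree x (num (2 * i)) f g \<longrightarrow>
      (\<forall>y\<in>elts x. (\<forall>z\<in>elts x. rel g (num (2 * i)) z \<longleftrightarrow> z = y) \<longrightarrow> holds x (code_of \<phi>) g))"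
    unfolding code_of.simps holds.simps single_def by blast
  also have "\<dots> \<longleftrightarrow> (\<forall>y\<in>elts x. sat (elts x) (s(i := y)) S \<phi>)" (is "?L \<longleftrightarrow> ?R")
  proof
    assume L: ?L
    show ?R
    proof
      fix y assume y: "y \<in> elts x"
      obtain g where g: "g \<in> subsets x" "agree x (num (2 * i)) f g"
        "\<forall>z\<in>elts x. rel g (num (2 * i)) z \<longleftrightarrow> z = y"
        using assignment_update[OF x universe_num[OF x], of "2 * i" f "{y}"]
        unfolding singleton_iff by blast
      then have "holds x (code_of \<phi>) g" using L y by blast
      then show "sat (elts x) (s(i := y)) S \<phi>" using IH[OF g(1,2) y g(3)] by simp
    qed
  next
    assume ?R
    then show ?L using IH by blast
  qed
  finally show ?case by simp
next
  case (Forall2 i \<phi>)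
  have IH: "holds x (code_of \<phi>) g \<longleftrightarrow> sat (elts x) s (S(i := Y)) \<phi>"
    if g: "g \<in> subsets x" "agree x (num (2 * i + 1)) f g" "Y \<subseteq> elts x"
      "\<forall>z\<in>elts x. rel g (num (2 * i + 1)) z \<longleftrightarrow> z \<in> Y" for g Y
  proof (rule Forall2.IH[OF g(1)])
    have ag: "rel g (num k) z \<longleftrightarrow> rel f (num k) z" if "k \<noteq> 2 * i + 1" "z \<in> elts x" for k z
    proof -
      have "num k \<noteq> (num (2 * i + 1) :: 'v)" using that(1) unfolding num_inject .
      then show ?thesis
        using g(2) that(2) universe_num[OF x, of k] unfolding agree_def by blast
    qed
    fix j
    have "2 * j \<noteq> 2 * i + 1" by presburger
    then show "s j \<in> elts x \<and> (\<forall>z\<in>elts x. rel g (num (2 * j)) z \<longleftrightarrow> z = s j)"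
      if "j \<in> free_vars \<phi>"
      using ag[of "2 * j"] Forall2.prems(2)[of j] that by simp
    show "(S(i := Y)) j \<subseteq> elts x \<and> (\<forall>y\<in>elts x. rel g (num (2 * j + 1)) y \<longleftrightarrow> y \<in> (S(i := Y)) j)"
      if "j \<in> free_set_vars \<phi>"
      using g(3,4) ag[of "2 * j + 1"] Forall2.prems(3)[of j] that by (cases "j = i") auto
  qed
  have "(\<forall>g\<in>subsets x. agree x (num (2 * i + 1)) f g \<longrightarrow> holds x (code_of \<phi>) g) \<longleftrightarrow>
      (\<forall>Y\<subseteq>elts x. sat (elts x) s (S(i := Y)) \<phi>)" (is "?L \<longleftrightarrow> ?R")
  proof
    assume L: ?L
    show ?R
    proof (intro allI impI)
      fix Y assume Y: "Y \<subseteq> elts x"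
      obtain g where g: "g \<in> subsets x" "agree x (num (2 * i + 1)) f g"
        "\<forall>z\<in>elts x. rel g (num (2 * i + 1)) z \<longleftrightarrow> z \<in> Y"
        using assignment_update[OF x universe_num[OF x], of "2 * i + 1" f Y] by blast
      then have "holds x (code_of \<phi>) g" using L by blast
      then show "sat (elts x) s (S(i := Y)) \<phi>" using IH[OF g(1,2) Y g(3)] by simp
    qed
  next
    assume R: ?R
    show ?L
    proof (intro ballI impI)
      fix g assume g: "g \<in> subsets x" "agree x (num (2 * i + 1)) f g"
      let ?Y = "{z \<in> elts x. rel g (num (2 * i + 1)) z}"
      have "sat (elts x) s (S(i := ?Y)) \<phi>" by (rule R[rule_format]) simp
      then show "holds x (code_of \<phi>) g" using IH[OF g, of ?Y] by simp
    qed
  qed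
  then show ?case by simp
qed

text \<open>Without free variables, one \<open>f\<close> codes all assignments at once; later uses
  can therefore take the empty one.\<close>

lemma holds_code_of_sentence:
  assumes "inaccessible \<gamma>" "elts x = Vset \<gamma>" "sentence \<sigma>" "f \<in> subsets x"
  shows "holds x (code_of \<sigma>) f \<longleftrightarrow> Vset \<gamma> \<Turnstile> \<sigma>"
proof -
  have x: "universe (elts x)" using assms(1,2) by (auto simp: universe_def)
  have sat: "holds x (code_of \<sigma>) f \<longleftrightarrow> sat (Vset \<gamma>) s S \<sigma>" for s S
    using holds_code_of[OF x assms(4), of \<sigma> s S] assms(2,3) by (simp add: sentence_def)
  have "range (\<lambda>_. num 0) \<subseteq> Vset \<gamma>" using universe_num[OF x] assms(2) by blast
  then have "sat (Vset \<gamma>) (\<lambda>_. num 0) (\<lambda>_. {}) \<sigma>" if "Vset \<gamma> \<Turnstile> \<sigma>"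
    using that by (simp add: models_def)
  moreover have "Vset \<gamma> \<Turnstile> \<sigma>" if "holds x (code_of \<sigma>) f"
    using that sat by (simp add: models_def)
  ultimately show ?thesis using sat by blast
qed

section \<open>Definability of truth for a fixed code\<close>

lemma definable_meet: "definable (\<lambda>M s. meet (s i) (s j) (s k) (s l))"
  unfolding meet_def by (intro definable_intros definable_rel)

lemma definable_below: "definable (\<lambda>M s. below (s i) (s j) (s k) (s l))"
  unfolding below_def by (intro definable_intros definable_rel)

lemma definable_single: "definable (\<lambda>M s. single (s i) (s j) (s k))"
  unfolding single_def by (intro definable_intros definable_rel)

lemma definable_agree: "definable (\<lambda>M s. agree (s i) (s j) (s k) (s l))"
  unfolding agree_def by (intro definable_intros definable_rel)

lemma definable_subst_num:
  assumes "definable (\<lambda>M s. Q M (\<lambda>n. s (Suc n)) (s 0))"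
  shows "definable (\<lambda>M s. Q M s (num k))"
proof (rule definable_cong)
  show "definable (\<lambda>M s. \<exists>a\<in>M. a = num k \<and> Q M s a)"
    by (intro definable_intros definable_num assms)
qed (use universe_num in auto)

text \<open>Each code receives its own formula, by a recursion on \<open>t\<close> carried out in
  HOL. Quantifying over \<open>t\<close> inside a formula takes the closed families below.\<close>

lemma definable_holds: "definable (\<lambda>M (s :: nat \<Rightarrow> 'v::zfc). holds (s i) t (s j))"
proof (induction t arbitrary: i j)
  case (Meet k l)
  show ?case unfolding holds.simps
    by (rule definable_subst_num[of "\<lambda>M s a. meet (s i) a (num l) (s j)" k],
        rule definable_subst_num[of "\<lambda>M s b. meet (s (Suc i)) (s 0) b (s (Suc j))" l],
        rule definable_meet)
next
  case (Below k l)
  show ?case unfolding holds.simps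
    by (rule definable_subst_num[of "\<lambda>M s a. below (s i) a (num l) (s j)" k],
        rule definable_subst_num[of "\<lambda>M s b. below (s (Suc i)) (s 0) b (s (Suc j))" l],
        rule definable_below)
next
  case (Single k)
  show ?case unfolding holds.simps
    by (rule definable_subst_num[of "\<lambda>M s a. single (s i) a (s j)" k], rule definable_single)
next
  case (Nand t u)
  show ?case unfolding holds.simps by (intro definable_intros Nand)
next
  case (All k t)
  show ?case unfolding holds.simps
    by (rule definable_subst_num[of
          "\<lambda>M s a. \<forall>g\<in>subsets (s i). agree (s i) a (s j) g \<longrightarrow> holds (s i) t g" k],
        intro definable_intros definable_agree All)
qed

section \<open>Quantifying over codes\<close>

text \<open>Links an element of the universe to a HOL predicate. \<open>J\<close> will be a set of
  stages, so that one relation records the truth of a code at all of them.\<close>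

definition represents :: "'v::zfc \<Rightarrow> 'v \<Rightarrow> ('v \<Rightarrow> 'v \<Rightarrow> bool) \<Rightarrow> bool"
  where "represents J R P \<longleftrightarrow> (\<forall>x\<in>elts J. \<forall>f\<in>subsets x. rel R x f \<longleftrightarrow> P x f)"

text \<open>One clause for each constructor of \<open>code\<close>, with \<open>N\<close> as the set
  of variable names. No code is mentioned, so the notion is first-order.\<close>

definition closed_family :: "'v::zfc \<Rightarrow> 'v \<Rightarrow> 'v \<Rightarrow> bool"
  where "closed_family J N A \<longleftrightarrow>
    (\<forall>a\<in>elts N. \<forall>b\<in>elts N. \<exists>R\<in>elts A. represents J R (\<lambda>x f. meet x a b f)) \<and>
    (\<forall>a\<in>elts N. \<forall>b\<in>elts N. \<exists>R\<in>elts A. represents J R (\<lambda>x f. below x a b f)) \<and>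
    (\<forall>a\<in>elts N. \<exists>R\<in>elts A. represents J R (\<lambda>x f. single x a f)) \<and>
    (\<forall>Q\<in>elts A. \<forall>Q'\<in>elts A. \<exists>R\<in>elts A.
      represents J R (\<lambda>x f. \<not> (rel Q x f \<and> rel Q' x f))) \<and>
    (\<forall>a\<in>elts N. \<forall>Q\<in>elts A. \<exists>R\<in>elts A.
      represents J R (\<lambda>x f. \<forall>g\<in>subsets x. agree x a f g \<longrightarrow> rel Q x g))"

lemma closed_family_represents:
  assumes N: "elts N = range num" and A: "closed_family J N A"
  shows "\<exists>R\<in>elts A. represents J R (\<lambda>x f. holds x t f)"
proof (induction t)
  case (Nand t u)
  then obtain Q Q' where Q: "Q \<in> elts A" "represents J Q (\<lambda>x f. holds x t f)"
    "Q' \<in> elts A" "represents J Q' (\<lambda>x f. holds x u f)" by blast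
  obtain R where R: "R \<in> elts A" "represents J R (\<lambda>x f. \<not> (rel Q x f \<and> rel Q' x f))"
    using A Q(1,3) unfolding closed_family_def by blast
  have "represents J R (\<lambda>x f. holds x (Nand t u) f)"
    using Q(2,4) R(2) by (simp add: represents_def)
  then show ?case using R(1) by blast
next
  case (All k t)
  then obtain Q where Q: "Q \<in> elts A" "represents J Q (\<lambda>x f. holds x t f)" by blast
  have "num k \<in> elts N" using N by blast
  then obtain R where R: "R \<in> elts A"
    "represents J R (\<lambda>x f. \<forall>g\<in>subsets x. agree x (num k) f g \<longrightarrow> rel Q x g)"
    using A Q(1) unfolding closed_family_def by blast
  have "represents J R (\<lambda>x f. holds x (All k t) f)"
    using Q(2) R(2) by (simp add: represents_def)
  then show ?case using R(1) by blast
qed (use A in \<open>simp_all add: closed_family_def N\<close>)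

text \<open>The witness consists of the relations defined by codes and is, up to agreement on
  \<open>J\<close>, the least closed family.\<close>

lemma closed_family_exists:
  assumes M: "universe M" and J: "J \<in> M" and N: "elts N = range num"
  obtains A where "A \<in> M" "closed_family J N A"
    "\<And>R. R \<in> elts A \<Longrightarrow> \<exists>t. represents J R (\<lambda>x f. holds x t f)"
proof -
  let ?u = "vset (\<Union>y\<in>elts J. elts y)"
  let ?P = "vset (subsets ?u)"
  have u: "elts ?u = (\<Union>y\<in>elts J. elts y)" by (intro elts_vset small_UN) auto
  have P: "f \<in> elts ?P" if "x \<in> elts J" "f \<in> subsets x" for x f
    using that u by auto
  obtain c where c: "c \<in> M" "\<And>x f. x \<in> elts J \<Longrightarrow> f \<in> elts ?P \<Longrightarrow> pair x f \<in> elts c"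
    by (rule universe_times[OF M J universe_Pow[OF M universe_Union[OF M J]]]) blast
  define R where "R t = vset {pair x f | x f. x \<in> elts J \<and> f \<in> subsets x \<and> holds x t f}" for t
  have sub: "{pair x f | x f. x \<in> elts J \<and> f \<in> subsets x \<and> holds x t f} \<subseteq> elts c" for t
    using c(2) P by blast
  have R: "elts (R t) = {pair x f | x f. x \<in> elts J \<and> f \<in> subsets x \<and> holds x t f}" for t
    unfolding R_def by (rule elts_vset[OF small_subset[OF small_elts sub]])
  have rel_R: "rel (R t) x f \<longleftrightarrow> holds x t f" if "x \<in> elts J" "f \<in> subsets x" for t x f
    using that unfolding rel_def R by simp
  \<comment> \<open>All these relations are subsets of the single set \<open>c\<close>, which makes
    the family small and an element of \<open>M\<close>.\<close>
  have range_R: "range R \<subseteq> elts (vset (subsets c))"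
    using sub by (auto simp: R)
  define A where "A = vset (range R)"
  have A: "elts A = range R"
    unfolding A_def by (rule elts_vset[OF small_subset[OF small_elts range_R]])
  have "A \<in> M"
    by (rule universe_subset[OF M universe_Pow[OF M c(1)]]) (simp only: A range_R)
  have rep: "represents J (R t) P \<longleftrightarrow> (\<forall>x\<in>elts J. \<forall>f\<in>subsets x. holds x t f \<longleftrightarrow> P x f)" for t P
    unfolding represents_def using rel_R by simp
  have "closed_family J N A"
    unfolding closed_family_def A N
  proof (intro conjI ballI; (elim rangeE)?)
    fix a b :: 'a and k l assume "a = num k" "b = num l"
    then show "\<exists>R\<in>range R. represents J R (\<lambda>x f. meet x a b f)"
      by (intro bexI[of _ "R (Meet k l)"]) (simp_all add: rep)
  next
    fix a b :: 'a and k l assume "a = num k" "b = num l"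
    then show "\<exists>R\<in>range R. represents J R (\<lambda>x f. below x a b f)"
      by (intro bexI[of _ "R (Below k l)"]) (simp_all add: rep)
  next
    fix a :: 'a and k assume "a = num k"
    then show "\<exists>R\<in>range R. represents J R (\<lambda>x f. single x a f)"
      by (intro bexI[of _ "R (Single k)"]) (simp_all add: rep)
  next
    fix Q Q' t u assume "Q = R t" "Q' = R u"
    then show "\<exists>R\<in>range R. represents J R (\<lambda>x f. \<not> (rel Q x f \<and> rel Q' x f))"
      by (intro bexI[of _ "R (Nand t u)"]) (simp_all add: rep rel_R)
  next
    fix a :: 'a and k Q t assume "a = num k" "Q = R t"
    then show "\<exists>R\<in>range R. represents J R (\<lambda>x f. \<forall>g\<in>subsets x. agree x a f g \<longrightarrow> rel Q x g)"
      by (intro bexI[of _ "R (All k t)"]) (simp_all add: rep rel_R)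
  qed
  moreover have "\<exists>t. represents J Q (\<lambda>x f. holds x t f)" if "Q \<in> elts A" for Q
    using that by (auto simp: A rep)
  ultimately show ?thesis using that \<open>A \<in> M\<close> by blast
qed

lemma definable_closed_family: "definable (\<lambda>M s. closed_family (s i) (s j) (s k))"
  unfolding closed_family_def represents_def
  by (intro definable_intros definable_meet definable_below definable_single definable_agree
      definable_rel)

text \<open>The codes are not elements of the universe; the relations that they define are the ones
  forced into every closed family.\<close>

lemma definable_ex_code:
  "definable (\<lambda>M (s :: nat \<Rightarrow> 'v::zfc). \<exists>t. \<forall>x\<in>elts (s i). \<forall>f\<in>subsets x. holds x t f \<longleftrightarrow> x = s j)"
proof (rule definable_cong)
  show "definable (\<lambda>M (s :: nat \<Rightarrow> 'v). \<exists>N\<in>M. elts N = range num \<and>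
      (\<forall>A\<in>M. closed_family (s i) N A \<longrightarrow>
        (\<exists>R\<in>elts A. \<forall>x\<in>elts (s i). \<forall>f\<in>subsets x. rel R x f \<longleftrightarrow> x = s j)))"
    by (intro definable_intros definable_nums definable_closed_family definable_rel)
  show "(\<exists>N\<in>M. elts N = range num \<and> (\<forall>A\<in>M. closed_family (s i) N A \<longrightarrow>
        (\<exists>R\<in>elts A. \<forall>x\<in>elts (s i). \<forall>f\<in>subsets x. rel R x f \<longleftrightarrow> x = s j))) \<longleftrightarrow>
      (\<exists>t. \<forall>x\<in>elts (s i). \<forall>f\<in>subsets x. holds x t f \<longleftrightarrow> x = s j)" (is "?L \<longleftrightarrow> ?R")
    if M: "universe M" and s: "range s \<subseteq> M" for M :: "'v set" and s
  proof
    assume ?L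
    then obtain N where N: "elts N = range num" "\<And>A. A \<in> M \<Longrightarrow> closed_family (s i) N A \<Longrightarrow>
        \<exists>R\<in>elts A. \<forall>x\<in>elts (s i). \<forall>f\<in>subsets x. rel R x f \<longleftrightarrow> x = s j" by blast
    \<comment> \<open>The least closed family is an admissible instance of the quantifier over
      \<open>A\<close>, so the relation it supplies comes from a code.\<close>
    obtain A where A: "A \<in> M" "closed_family (s i) N A"
      "\<And>R. R \<in> elts A \<Longrightarrow> \<exists>t. represents (s i) R (\<lambda>x f. holds x t f)"
      by (rule closed_family_exists[OF M range_subsetD[OF s, of i] N(1)]) blast
    obtain R where R: "R \<in> elts A" "\<forall>x\<in>elts (s i). \<forall>f\<in>subsets x. rel R x f \<longleftrightarrow> x = s j"
      using N(2)[OF A(1,2)] by blast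
    obtain t where "represents (s i) R (\<lambda>x f. holds x t f)" using A(3)[OF R(1)] by blast
    then show ?R using R(2) by (intro exI[of _ t]) (simp add: represents_def)
  next
    assume ?R
    then obtain t where t: "\<forall>x\<in>elts (s i). \<forall>f\<in>subsets x. holds x t f \<longleftrightarrow> x = s j" by blast
    obtain N where N: "N \<in> M" "elts N = range num" using universe_num_set[OF M] by blast
    have "\<exists>R\<in>elts A. \<forall>x\<in>elts (s i). \<forall>f\<in>subsets x. rel R x f \<longleftrightarrow> x = s j"
      if A: "closed_family (s i) N A" for A
    proof -
      obtain R where "R \<in> elts A" "represents (s i) R (\<lambda>x f. holds x t f)"
        using closed_family_represents[OF N(2) A] by blast
      then show ?thesis using t by (intro bexI[of _ R]) (simp_all add: represents_def)
    qed
    then show ?L using N by blast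
  qed
qed

section \<open>Categoricity\<close>

text \<open>For the code of a sentence this says that an inaccessible stage inside \<open>M\<close>
  satisfies it. For other codes truth may depend on the assignment, hence the existential quantifier
  over \<open>f\<close>.\<close>

definition code_realized :: "code \<Rightarrow> 'v::zfc set \<Rightarrow> bool"
  where "code_realized t M \<longleftrightarrow> (\<exists>\<gamma>\<in>M. inaccessible \<gamma> \<and>
    (\<exists>x\<in>M. (ordinal \<gamma> \<and> elts x = Vset \<gamma>) \<and> (\<exists>f\<in>subsets x. holds x t f)))"

lemma definable_code_realized: "definable (\<lambda>M s. code_realized t M)"
  unfolding code_realized_def
  by (intro definable_ex definable_conj definable_inaccessible definable_stage
      definable_bex_subsets definable_holds)

text \<open>\<open>J\<close> must contain every inaccessible stage up to
  \<open>Vset \<gamma>\<close>, and the code distinguishes \<open>v\<close> from the rest, so no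
  earlier inaccessible stage realizes it. Bounding the stages by a set puts the quantifier over
  codes into the form of \<open>definable_ex_code\<close>.\<close>

definition first_realized :: "'v::zfc set \<Rightarrow> 'v \<Rightarrow> bool"
  where "first_realized M \<gamma> \<longleftrightarrow> (\<exists>J\<in>M. \<exists>v\<in>M. (ordinal \<gamma> \<and> elts v = Vset \<gamma>) \<and>
    (\<forall>\<gamma>'\<in>M. (\<gamma>' = \<gamma> \<or> \<gamma>' \<in> elts \<gamma>) \<and> inaccessible \<gamma>' \<longrightarrow>
      (\<exists>x\<in>elts J. ordinal \<gamma>' \<and> elts x = Vset \<gamma>')) \<and>
    (\<exists>t. \<forall>x\<in>elts J. \<forall>f\<in>subsets x. holds x t f \<longleftrightarrow> x = v))"

lemma definable_first_realized: "definable (\<lambda>M s. first_realized M (s i))"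
  unfolding first_realized_def
  by (intro definable_all definable_ex definable_imp definable_conj definable_disj definable_bex
      definable_eq definable_mem definable_inaccessible definable_stage definable_ex_code)

definition first_realized_unbounded :: "'v::zfc set \<Rightarrow> bool"
  where "first_realized_unbounded M \<longleftrightarrow> (\<forall>\<delta>\<in>M. inaccessible \<delta> \<longrightarrow>
    (\<exists>\<gamma>\<in>M. inaccessible \<gamma> \<and> (\<delta> = \<gamma> \<or> \<delta> \<in> elts \<gamma>) \<and> first_realized M \<gamma>))"

lemma definable_first_realized_unbounded: "definable (\<lambda>M s. first_realized_unbounded M)"
  unfolding first_realized_unbounded_def
  by (intro definable_intros definable_inaccessible definable_first_realized)

lemma sententially_categorical_sentence:
  assumes "sententially_categorical \<gamma>"
  obtains \<sigma> where "inaccessible \<gamma>" "sentence \<sigma>"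
    "\<And>\<mu>. inaccessible \<mu> \<Longrightarrow> Vset \<mu> \<Turnstile> \<sigma> \<longleftrightarrow> \<mu> = \<gamma>"
  using assms unfolding sententially_categorical_def first_order_sententially_categorical_def
    second_order_sententially_categorical_def by metis

lemma code_realizedI:
  assumes "universe M" "\<gamma> \<in> M" "inaccessible \<gamma>" "elts x = Vset \<gamma>" "f \<in> subsets x" "holds x t f"
  shows "code_realized t M"
proof -
  have "x = vset (Vset \<gamma>)" using assms(4) by (simp add: eq_vset_iff)
  then have "x \<in> M" using universe_stage[OF assms(1,2) inaccessible_ordinal[OF assms(3)]] by simp
  then show ?thesis unfolding code_realized_def using assms inaccessible_ordinal by blast
qed

lemma sentence_realized:
  assumes "universe M" "\<gamma> \<in> M" "inaccessible \<gamma>" "sentence \<sigma>" "Vset \<gamma> \<Turnstile> \<sigma>"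
  shows "code_realized (code_of \<sigma>) M"
proof (rule code_realizedI[OF assms(1-3)])
  show x: "elts (vset (Vset \<gamma>)) = Vset \<gamma>" by simp
  show "vset {} \<in> subsets (vset (Vset \<gamma>))" by simp
  then show "holds (vset (Vset \<gamma>)) (code_of \<sigma>) (vset {})"
    using holds_code_of_sentence[OF assms(3) x assms(4)] assms(5) by simp
qed

text \<open>The code of a sentence categorical for \<gamma> is true at \<open>Vset \<gamma>\<close>
  and at no other inaccessible stage, in particular at none of the earlier ones.\<close>

lemma sententially_categorical_first_realized_unbounded:
  fixes \<kappa> :: "'v::zfc"
  assumes \<kappa>: "inaccessible \<kappa>"
    and unbounded: "\<And>\<delta>. \<lbrakk>inaccessible \<delta>; \<delta> \<in> elts \<kappa>\<rbrakk> \<Longrightarrow>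
      \<exists>\<gamma>. sententially_categorical \<gamma> \<and> (\<delta> = \<gamma> \<or> \<delta> \<in> elts \<gamma>) \<and> \<gamma> \<in> elts \<kappa>"
  shows "first_realized_unbounded (Vset \<kappa>)"
  unfolding first_realized_unbounded_def
proof (intro ballI impI)
  have M: "universe (Vset \<kappa>)" using \<kappa> by (auto simp: universe_def)
  have ord: "ordinal \<mu>" if "inaccessible \<mu>" for \<mu> :: 'v using that inaccessible_ordinal by blast
  fix \<delta> assume "\<delta> \<in> Vset \<kappa>" and \<delta>: "inaccessible \<delta>"
  then have "\<delta> \<in> elts \<kappa>" using ordinal_in_Vset_iff[OF ord[OF \<delta>] ord[OF \<kappa>]] by simp
  then obtain \<gamma> where \<gamma>: "sententially_categorical \<gamma>" "\<delta> = \<gamma> \<or> \<delta> \<in> elts \<gamma>" "\<gamma> \<in> elts \<kappa>"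
    using unbounded[OF \<delta>] by blast
  obtain \<sigma> where inacc: "inaccessible \<gamma>" and \<sigma>: "sentence \<sigma>"
    "\<And>\<mu>. inaccessible \<mu> \<Longrightarrow> Vset \<mu> \<Turnstile> \<sigma> \<longleftrightarrow> \<mu> = \<gamma>"
    by (rule sententially_categorical_sentence[OF \<gamma>(1)]) blast
  have \<gamma>_in: "\<gamma> \<in> Vset \<kappa>" using \<gamma>(3) elts_subset_Vset by blast
  let ?st = "\<lambda>\<mu>. vset (Vset \<mu>)"
  let ?I = "{\<mu> \<in> elts (vsucc \<gamma>). inaccessible \<mu>}"
  \<comment> \<open>The inaccessible stages up to and including that of \<gamma>. All are subsets of
    \<open>Vset \<gamma>\<close>, so \<open>J\<close> lies within its power set and belongs to
    \<open>Vset \<kappa>\<close>.\<close>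
  define J where "J = vset (?st ` ?I)"
  have J: "elts J = ?st ` ?I"
    unfolding J_def by (intro elts_vset small_image small_subset[OF small_elts[of "vsucc \<gamma>"]]) blast
  have "Vset \<mu> \<subseteq> Vset \<gamma>" if "\<mu> \<in> elts (vsucc \<gamma>)" for \<mu>
    using that Vset_mono_mem[OF ord[OF inacc]] by auto
  then have "elts J \<subseteq> elts (vset (subsets (?st \<gamma>)))"
    by (auto simp: J)
  then have J_in: "J \<in> Vset \<kappa>"
    by (rule universe_subset[OF M universe_Pow[OF M universe_stage[OF M \<gamma>_in ord[OF inacc]]]])
  have code: "holds x (code_of \<sigma>) f \<longleftrightarrow> x = ?st \<gamma>" if x: "x \<in> elts J" "f \<in> subsets x" for x f
  proof -
    obtain \<mu> where \<mu>: "x = ?st \<mu>" "inaccessible \<mu>" using x(1) by (auto simp: J)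
    have "holds x (code_of \<sigma>) f \<longleftrightarrow> \<mu> = \<gamma>"
      using holds_code_of_sentence[OF \<mu>(2) _ \<sigma>(1) x(2)] \<sigma>(2)[OF \<mu>(2)] \<mu>(1) by simp
    also have "\<dots> \<longleftrightarrow> x = ?st \<gamma>"
    proof
      assume "x = ?st \<gamma>"
      \<comment> \<open>Equal stages have equal indices: a smaller index would otherwise be an
        element of its own stage.\<close>
      then have eq: "Vset \<mu> = Vset \<gamma>" using \<mu>(1) by (metis elts_vset small_Vset)
      then have "\<mu> \<notin> elts \<gamma>" "\<gamma> \<notin> elts \<mu>"
        using elts_subset_Vset notin_Vset_self by blast+
      then show "\<mu> = \<gamma>" using ordinal_linear[OF ord[OF \<mu>(2)] ord[OF inacc]] by blast
    qed (simp add: \<mu>(1))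
    finally show ?thesis .
  qed
  have "first_realized (Vset \<kappa>) \<gamma>"
    unfolding first_realized_def
  proof (rule bexI[OF _ J_in], rule bexI[OF _ universe_stage[OF M \<gamma>_in ord[OF inacc]]],
      intro conjI ballI impI)
    fix \<gamma>' assume \<gamma>': "(\<gamma>' = \<gamma> \<or> \<gamma>' \<in> elts \<gamma>) \<and> inaccessible \<gamma>'"
    then have "?st \<gamma>' \<in> elts J" by (auto simp: J)
    then show "\<exists>x\<in>elts J. ordinal \<gamma>' \<and> elts x = Vset \<gamma>'"
      using ord \<gamma>' by (intro bexI[of _ "?st \<gamma>'"]) auto
  next
    show "\<exists>t. \<forall>x\<in>elts J. \<forall>f\<in>subsets x. holds x t f \<longleftrightarrow> x = ?st \<gamma>"
      using code by blast
  qed (use ord[OF inacc] in simp_all)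
  then show "\<exists>\<gamma>\<in>Vset \<kappa>. inaccessible \<gamma> \<and> (\<delta> = \<gamma> \<or> \<delta> \<in> elts \<gamma>) \<and> first_realized (Vset \<kappa>) \<gamma>"
    using inacc \<gamma>(2) \<gamma>_in by blast
qed

text \<open>Instantiating the bound with \<kappa> itself yields \<gamma> not below \<kappa>. A
  realization of the code inside \<open>Vset \<kappa>\<close> would happen at a stage in
  \<open>J\<close> strictly before that of \<gamma>, where the code is false.\<close>

lemma first_realized_unbounded_above:
  fixes \<kappa> :: "'v::zfc"
  assumes M: "universe M" and "first_realized_unbounded M" and \<kappa>: "\<kappa> \<in> M" "inaccessible \<kappa>"
  obtains t where "code_realized t M" "\<not> code_realized t (Vset \<kappa>)"
proof -
  have ord: "ordinal \<mu>" if "inaccessible \<mu>" for \<mu> :: 'v using that inaccessible_ordinal by blast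
  obtain \<gamma> where \<gamma>: "\<gamma> \<in> M" "inaccessible \<gamma>" "\<kappa> = \<gamma> \<or> \<kappa> \<in> elts \<gamma>"
    "first_realized M \<gamma>"
    using assms(2) \<kappa> unfolding first_realized_unbounded_def by blast
  from \<gamma>(4) show ?thesis
    unfolding first_realized_def
  proof (elim bexE conjE exE)
    fix J v t assume v: "elts v = Vset \<gamma>"
      and J: "\<forall>\<gamma>'\<in>M. (\<gamma>' = \<gamma> \<or> \<gamma>' \<in> elts \<gamma>) \<and> inaccessible \<gamma>' \<longrightarrow>
        (\<exists>x\<in>elts J. ordinal \<gamma>' \<and> elts x = Vset \<gamma>')"
      and t: "\<forall>x\<in>elts J. \<forall>f\<in>subsets x. holds x t f \<longleftrightarrow> x = v"
    have stage_in_J: "x \<in> elts J"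
      if \<gamma>': "\<gamma>' \<in> M" "\<gamma>' = \<gamma> \<or> \<gamma>' \<in> elts \<gamma>" "inaccessible \<gamma>'" "elts x = Vset \<gamma>'" for \<gamma>' x
    proof -
      obtain y where "y \<in> elts J" "elts y = Vset \<gamma>'"
        using J[rule_format, OF \<gamma>'(1) conjI[OF \<gamma>'(2,3)]] by (elim bexE conjE) (rule that)
      then show ?thesis using \<gamma>'(4) elts_inject[of x y] by simp
    qed
    have "v \<in> elts J" using stage_in_J[OF \<gamma>(1) _ \<gamma>(2) v] by simp
    then have "holds v t (vset {})" using t by simp
    then have "code_realized t M"
      by (intro code_realizedI[OF M \<gamma>(1,2) v, of "vset {}"]) simp_all
    moreover have "\<not> code_realized t (Vset \<kappa>)"
    proof
      assume "code_realized t (Vset \<kappa>)"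
      then obtain \<gamma>' x f where \<gamma>': "\<gamma>' \<in> Vset \<kappa>" "inaccessible \<gamma>'" "elts x = Vset \<gamma>'"
        and f: "f \<in> subsets x" "holds x t f"
        unfolding code_realized_def by blast
      have "\<gamma>' \<in> elts \<kappa>" using \<gamma>'(1) ordinal_in_Vset_iff[OF ord[OF \<gamma>'(2)] ord[OF \<kappa>(2)]] by simp
      then have mem: "\<gamma>' \<in> elts \<gamma>" "\<gamma>' \<in> M"
        using \<gamma>(3) ordinal_trans[OF ord[OF \<gamma>(2)]] universe_trans[OF M \<kappa>(1)] by blast+
      then have "x \<in> elts J" using stage_in_J[OF _ _ \<gamma>'(2,3)] by simp
      then have "x = v" using t f by blast
      then have "Vset \<gamma>' = Vset \<gamma>" using v \<gamma>'(3) by simp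
      then show False using mem(1) elts_subset_Vset[of \<gamma>] notin_Vset_self[of \<gamma>'] by blast
    qed
    ultimately show thesis by (rule that)
  qed
qed

theorem theorem9:
  fixes \<kappa> :: "'v::zfc"
  assumes "inaccessible \<kappa>"
    and "\<And>\<delta>. \<lbrakk>inaccessible \<delta>; \<delta> \<in>\<^sub>V \<kappa>\<rbrakk> \<Longrightarrow>
      \<exists>\<gamma>. sententially_categorical \<gamma> \<and> (\<delta> = \<gamma> \<or> \<delta> \<in>\<^sub>V \<gamma>) \<and> \<gamma> \<in>\<^sub>V \<kappa>"
  shows "first_order_theory_categorical \<kappa>"
proof -
  note unbounded = assms(2)[folded elts_iff]
  have ord: "ordinal \<mu>" if "inaccessible \<mu>" for \<mu> :: 'v using that inaccessible_ordinal by blast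
  let ?T = "{\<sigma>. sentence \<sigma> \<and> first_order \<sigma> \<and> Vset \<kappa> \<Turnstile> \<sigma>}"
  have False if \<mu>: "inaccessible \<mu>" "\<mu> \<noteq> \<kappa>" and T: "Vset \<mu> \<Turnstile>\<^sub>T ?T" for \<mu>
  proof -
    have U: "universe (Vset \<kappa>)" "universe (Vset \<mu>)"
      using assms(1) \<mu>(1) by (auto simp: universe_def)
    have transfer: "P (Vset \<kappa>) \<longleftrightarrow> P (Vset \<mu>)" if "definable (\<lambda>M s. P M)" for P
      using T by (intro definable_transfer[OF that U]) (simp add: models_theory_def)
    have "\<mu> \<in> elts \<kappa> \<or> \<kappa> \<in> elts \<mu>"
      using ordinal_linear[OF ord[OF \<mu>(1)] ord[OF assms(1)]] \<mu>(2) by blast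
    then show False
    proof
      assume "\<mu> \<in> elts \<kappa>"
      then obtain \<gamma> where \<gamma>: "sententially_categorical \<gamma>" "\<mu> = \<gamma> \<or> \<mu> \<in> elts \<gamma>" "\<gamma> \<in> elts \<kappa>"
        using unbounded[OF \<mu>(1)] by blast
      obtain \<sigma> where inacc: "inaccessible \<gamma>" and \<sigma>: "sentence \<sigma>"
        "\<And>\<mu>. inaccessible \<mu> \<Longrightarrow> Vset \<mu> \<Turnstile> \<sigma> \<longleftrightarrow> \<mu> = \<gamma>"
        by (rule sententially_categorical_sentence[OF \<gamma>(1)]) blast
      have "\<gamma> \<in> Vset \<kappa>" using \<gamma>(3) elts_subset_Vset by blast
      then have "code_realized (code_of \<sigma>) (Vset \<kappa>)"
        using sentence_realized[OF U(1) _ inacc \<sigma>(1)] \<sigma>(2)[OF inacc] by simp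
      then have "code_realized (code_of \<sigma>) (Vset \<mu>)"
        using transfer[OF definable_code_realized] by simp
      then obtain \<gamma>' x f where \<gamma>': "\<gamma>' \<in> Vset \<mu>" "inaccessible \<gamma>'" "elts x = Vset \<gamma>'"
        and f: "f \<in> subsets x" "holds x (code_of \<sigma>) f"
        unfolding code_realized_def by blast
      \<comment> \<open>Categoricity identifies the realizing cardinal, so \<gamma> lies below
        \<mu>, contrary to its choice at or above \<mu>.\<close>
      have "\<gamma>' = \<gamma>"
        using holds_code_of_sentence[OF \<gamma>'(2,3) \<sigma>(1) f(1)] f(2) \<sigma>(2)[OF \<gamma>'(2)] by simp
      then have "\<gamma> \<in> elts \<mu>"
        using \<gamma>'(1) ordinal_in_Vset_iff[OF ord[OF inacc] ord[OF \<mu>(1)]] by simp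
      then show False using \<gamma>(2) elts_not_sym by auto
    next
      assume "\<kappa> \<in> elts \<mu>"
      then have "\<kappa> \<in> Vset \<mu>" using elts_subset_Vset by blast
      moreover have "first_realized_unbounded (Vset \<mu>)"
        using transfer[OF definable_first_realized_unbounded]
          sententially_categorical_first_realized_unbounded[OF assms(1) unbounded] by simp
      ultimately obtain t where "code_realized t (Vset \<mu>)" "\<not> code_realized t (Vset \<kappa>)"
        using first_realized_unbounded_above[OF U(2) _ _ assms(1)] by blast
      then show False using transfer[OF definable_code_realized] by simp
    qed
  qed
  then show ?thesis
    unfolding first_order_theory_categorical_def
    using assms(1)
    by (intro conjI exI[of _ ?T]) (auto simp: first_order_theory_def models_theory_def)
qed

end
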